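(* Let $\Omega$ be an infinite compact Hausdorff space, let $X$ be an infinite-dimensional Banach space, and let $Y\neq\{0\}$ be a Banach space. Then there exists an operator $S\in\mathcal{L}(\mathcal{C}(\Omega),\mathcal{L}(X,Y))$ which is not associated to any $U\in\mathcal{L}(\mathcal{C}(\Omega,X),Y)$, i.e., $S\neq U^{\#}$ for all $U\in\mathcal{L}(\mathcal{C}(\Omega,X),Y)$.
   Context: All Banach spaces are over the same field $\mathbb{K}$ ($\mathbb{R}$ or $\mathbb{C}$); $\mathcal{L}(X,Y)$ is the Banach space of bounded linear operators. $\mathcal{C}(\Omega)$ and $\mathcal{C}(\Omega,X)$ are the Banach spaces of continuous $\mathbb{K}$-valued and $X$-valued functions on $\Omega$ with the supremum norm. For $U\in\mathcal{L}(\mathcal{C}(\Omega,X),Y)$, the associated operator $U^{\#}\in\mathcal{L}(\mathcal{C}(\Omega),\mathcal{L}(X,Y))$ is defined by $(U^{\#}\varphi)x=U(\varphi x)$, $\varphi\in\mathcal{C}(\Omega)$, $x\in X$, where $\varphi x$ is the function $\omega\mapsto\varphi(\omega)x$. *)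

theory Defs
  imports "HOL-Analysis.Analysis"
begin

text \<open>
  The scalar field is a type of class \<open>real_or_complex\<close>. The algebraic condition makes it
  \<open>\<real>\<close> or \<open>\<complex>\<close> as a field over \<open>\<real>\<close>, and the norm of a \<^class>\<open>real_normed_field\<close>, being multiplicative,
  then has to be the usual absolute value.
\<close>

class real_or_complex = real_normed_field +
  assumes real_or_complex:
    "(\<forall>z::'a. \<exists>a. z = a *\<^sub>R 1) \<or>
     (\<exists>i::'a. i * i = - 1 \<and> (\<forall>z. \<exists>a b. z = a *\<^sub>R 1 + b *\<^sub>R i))"

instance real :: real_or_complex
  by standard simp

instance complex :: real_or_complex
proof
  have "z = Re z *\<^sub>R 1 + Im z *\<^sub>R \<i>" for z
    by (simp add: complex_eq_iff)
  then show "(\<forall>z::complex. \<exists>a. z = a *\<^sub>R 1) \<or>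
     (\<exists>i::complex. i * i = - 1 \<and> (\<forall>z. \<exists>a b. z = a *\<^sub>R 1 + b *\<^sub>R i))"
    by (metis i_squared)
qed

text \<open>
  The library's normed spaces are real. A normed space over \<open>'k\<close> is a real normed space with a
  multiplication by scalars from \<open>'k\<close> that extends the real one and is compatible with the norm;
  it is a Banach space over \<open>'k\<close> if its type is of class \<^class>\<open>banach\<close>.
\<close>

locale normed_space_over = vector_space s
  for s :: "'k::real_or_complex \<Rightarrow> 'x::real_normed_vector \<Rightarrow> 'x" +
  assumes scale_of_real: "s (of_real r) x = r *\<^sub>R x"
    and norm_scale: "norm (s c x) = norm c * norm x"

lemma normed_space_over_real_iff:
  "normed_space_over (s :: real \<Rightarrow> 'x::real_normed_vector \<Rightarrow> 'x) \<longleftrightarrow> s = scaleR"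
proof
  assume "normed_space_over s"
  then interpret normed_space_over s .
  show "s = scaleR"
    using scale_of_real by (intro ext) simp
next
  assume "s = scaleR"
  then show "normed_space_over s"
    by unfold_locales (auto simp: algebra_simps)
qed

lemma normed_space_over_mult: "normed_space_over ((*) :: 'k::real_or_complex \<Rightarrow> 'k \<Rightarrow> 'k)"
  by unfold_locales (auto simp: algebra_simps norm_mult scaleR_conv_of_real)

text \<open>The \<open>'k\<close>-linear bounded operators, \<open>\<L>(X,Y)\<close>, as a subset of the real-linear ones.\<close>

definition blinfun_over ::
  "('k::real_or_complex \<Rightarrow> 'x::real_normed_vector \<Rightarrow> 'x) \<Rightarrow>
   ('k \<Rightarrow> 'y::real_normed_vector \<Rightarrow> 'y) \<Rightarrow> ('x \<Rightarrow>\<^sub>L 'y) set"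
  where "blinfun_over s t = {T. Vector_Spaces.linear s t (blinfun_apply T)}"

definition blinfun_scale ::
  "('k::real_or_complex \<Rightarrow> 'y::real_normed_vector \<Rightarrow> 'y) \<Rightarrow>
   'k \<Rightarrow> ('x::real_normed_vector \<Rightarrow>\<^sub>L 'y) \<Rightarrow> 'x \<Rightarrow>\<^sub>L 'y"
  where "blinfun_scale t c T = Blinfun (\<lambda>x. t c (T x))"

text \<open>
  For compact \<open>\<Omega>\<close>, given as a topological space type, \<open>\<C>(\<Omega>,X)\<close> is the library's space of bounded
  continuous functions with the supremum norm.
\<close>

definition bcontfun_scale ::
  "('k::real_or_complex \<Rightarrow> 'x::real_normed_vector \<Rightarrow> 'x) \<Rightarrow>
   'k \<Rightarrow> ('w::topological_space \<Rightarrow>\<^sub>C 'x) \<Rightarrow> 'w \<Rightarrow>\<^sub>C 'x"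
  where "bcontfun_scale s c f = Bcontfun (\<lambda>w. s c (f w))"

definition bcontfun_vec ::
  "('k::real_or_complex \<Rightarrow> 'x::real_normed_vector \<Rightarrow> 'x) \<Rightarrow>
   ('w::topological_space \<Rightarrow>\<^sub>C 'k) \<Rightarrow> 'x \<Rightarrow> 'w \<Rightarrow>\<^sub>C 'x"
  where "bcontfun_vec s \<phi> x = Bcontfun (\<lambda>w. s (\<phi> w) x)"

text \<open>
  The space \<open>\<L>(\<C>(\<Omega>), \<L>(X,Y))\<close>: the values have to be \<open>'k\<close>-linear operators, and the dependence
  on the function has to be \<open>'k\<close>-linear.
\<close>

definition operator_valued_over ::
  "('k::real_or_complex \<Rightarrow> 'x::real_normed_vector \<Rightarrow> 'x) \<Rightarrow>
   ('k \<Rightarrow> 'y::real_normed_vector \<Rightarrow> 'y) \<Rightarrow>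
   (('w::topological_space \<Rightarrow>\<^sub>C 'k) \<Rightarrow>\<^sub>L ('x \<Rightarrow>\<^sub>L 'y)) set"
  where "operator_valued_over s t =
    {S \<in> blinfun_over (bcontfun_scale (*)) (blinfun_scale t). range (blinfun_apply S) \<subseteq> blinfun_over s t}"

text \<open>The associated operator \<open>U\<^sup>#\<close>.\<close>

definition assoc_op ::
  "('k::real_or_complex \<Rightarrow> 'x::real_normed_vector \<Rightarrow> 'x) \<Rightarrow>
   (('w::topological_space \<Rightarrow>\<^sub>C 'x) \<Rightarrow>\<^sub>L 'y::real_normed_vector) \<Rightarrow>
   ('w \<Rightarrow>\<^sub>C 'k) \<Rightarrow>\<^sub>L ('x \<Rightarrow>\<^sub>L 'y)"
  where "assoc_op s U = Blinfun (\<lambda>\<phi>. Blinfun (\<lambda>x. U (bcontfun_vec s \<phi> x)))"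

text \<open>
  \<^const>\<open>Blinfun\<close> and \<^const>\<open>Bcontfun\<close> are meaningful only on functions satisfying the defining
  conditions of the types; the following facts show that this is the case in the definitions above.
\<close>

context normed_space_over
begin

lemma bounded_bilinear_scale: "bounded_bilinear s"
proof
  show "\<exists>K. \<forall>a b. norm (s a b) \<le> norm a * norm b * K"
    by (rule exI[of _ 1]) (simp add: norm_scale)
next
  fix r a b
  show "s (r *\<^sub>R a) b = r *\<^sub>R s a b"
    by (metis scale_of_real scale_scale scaleR_conv_of_real)
  show "s a (r *\<^sub>R b) = r *\<^sub>R s a b"
    by (metis scale_of_real scale_scale mult.commute)
qed (simp_all add: scale_left_distrib scale_right_distrib)

lemma blinfun_scale_apply: "blinfun_apply (blinfun_scale s c T) x = s c (T x)"
  unfolding blinfun_scale_def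
  by (subst bounded_linear_Blinfun_apply)
    (auto intro: bounded_linear_compose[OF bounded_bilinear.bounded_linear_right[OF bounded_bilinear_scale]]
      blinfun.bounded_linear_right)

lemma bcontfun_scale_apply: "apply_bcontfun (bcontfun_scale s c f) w = s c (f w)"
proof -
  have bl: "bounded_linear (s c)"
    by (rule bounded_bilinear.bounded_linear_right[OF bounded_bilinear_scale])
  have "bounded (s c ` range f)"
    by (rule bounded_linear_image[OF bounded_apply_bcontfun bl])
  then have "(\<lambda>w. s c (f w)) \<in> bcontfun"
    unfolding bcontfun_def
    by (auto simp: image_image intro!: linear_continuous_on_compose linear_continuous_on bl
        bounded_linear.continuous_on[OF bl])
  then show ?thesis
    by (simp add: bcontfun_scale_def Bcontfun_inverse)
qed

lemma bcontfun_vec_apply: "apply_bcontfun (bcontfun_vec s \<phi> x) w = s (\<phi> w) x"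
proof -
  have bl: "bounded_linear (\<lambda>c. s c x)"
    by (rule bounded_bilinear.bounded_linear_left[OF bounded_bilinear_scale])
  have "bounded ((\<lambda>c. s c x) ` range \<phi>)"
    by (rule bounded_linear_image[OF bounded_apply_bcontfun bl])
  then have "(\<lambda>w. s (\<phi> w) x) \<in> bcontfun"
    unfolding bcontfun_def
    by (auto simp: image_image intro!: bounded_linear.continuous_on[OF bl])
  then show ?thesis
    by (simp add: bcontfun_vec_def Bcontfun_inverse)
qed

lemma normed_space_over_blinfun:
  "normed_space_over (blinfun_scale s :: 'k \<Rightarrow> ('z::real_normed_vector \<Rightarrow>\<^sub>L 'x) \<Rightarrow> _)"
proof
  fix c :: 'k and T :: "'z \<Rightarrow>\<^sub>L 'x"
  have le: "norm (blinfun_scale s c T) \<le> norm c * norm T" for c and T :: "'z \<Rightarrow>\<^sub>L 'x"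
    by (rule norm_blinfun_bound)
      (auto simp: blinfun_scale_apply norm_scale mult.assoc intro!: mult_left_mono norm_blinfun)
  show "norm (blinfun_scale s c T) = norm c * norm T"
  proof (cases "c = 0")
    case False
    have "T = blinfun_scale s (inverse c) (blinfun_scale s c T)"
      using False by (intro blinfun_eqI) (simp add: blinfun_scale_apply)
    then have "norm T \<le> norm (inverse c) * norm (blinfun_scale s c T)"
      by (metis le)
    then have "norm c * norm T \<le> norm (blinfun_scale s c T)"
      using False by (simp add: norm_divide field_simps)
    with le show ?thesis
      by (rule order_antisym)
  qed (use le[of 0 T] in simp)
qed (auto intro!: blinfun_eqI
      simp: blinfun_scale_apply blinfun.bilinear_simps scale_left_distrib scale_right_distrib scale_of_real)

lemma norm_bcontfun_vec: "norm (bcontfun_vec s \<phi> x) \<le> norm \<phi> * norm x"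
  by (rule norm_bound)
    (auto simp: bcontfun_vec_apply norm_scale intro!: mult_right_mono norm_bounded)

lemma bounded_bilinear_bcontfun_vec:
  "bounded_bilinear (bcontfun_vec s :: ('w::topological_space \<Rightarrow>\<^sub>C 'k) \<Rightarrow> _)"
proof
  show "\<exists>K. \<forall>(\<phi>::'w \<Rightarrow>\<^sub>C 'k) x. norm (bcontfun_vec s \<phi> x) \<le> norm \<phi> * norm x * K"
    by (rule exI[of _ 1]) (simp add: norm_bcontfun_vec)
qed (auto intro!: bcontfun_eqI simp: bcontfun_vec_apply scale_left_distrib scale_right_distrib
      bounded_bilinear.scaleR_left[OF bounded_bilinear_scale]
      bounded_bilinear.scaleR_right[OF bounded_bilinear_scale])

lemma normed_space_over_bcontfun:
  "normed_space_over (bcontfun_scale s :: 'k \<Rightarrow> ('w::topological_space \<Rightarrow>\<^sub>C 'x) \<Rightarrow> _)"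
proof
  fix c :: 'k and f :: "'w \<Rightarrow>\<^sub>C 'x"
  have le: "norm (bcontfun_scale s c f) \<le> norm c * norm f" for c and f :: "'w \<Rightarrow>\<^sub>C 'x"
    by (rule norm_bound)
      (auto simp: bcontfun_scale_apply norm_scale intro!: mult_left_mono norm_bounded)
  show "norm (bcontfun_scale s c f) = norm c * norm f"
  proof (cases "c = 0")
    case False
    have "f = bcontfun_scale s (inverse c) (bcontfun_scale s c f)"
      using False by (intro bcontfun_eqI) (simp add: bcontfun_scale_apply)
    then have "norm f \<le> norm (inverse c) * norm (bcontfun_scale s c f)"
      by (metis le)
    then have "norm c * norm f \<le> norm (bcontfun_scale s c f)"
      using False by (simp add: norm_divide field_simps)
    with le show ?thesis
      by (rule order_antisym)
  qed (use le[of 0 f] in simp)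
qed (auto intro!: bcontfun_eqI
      simp: bcontfun_scale_apply scale_left_distrib scale_right_distrib scale_of_real)

lemma assoc_op_apply: "blinfun_apply (blinfun_apply (assoc_op s U) \<phi>) x = U (bcontfun_vec s \<phi> x)"
proof -
  have bb: "bounded_bilinear (\<lambda>\<phi> x. blinfun_apply U (bcontfun_vec s \<phi> x))"
  proof
    show "\<exists>K. \<forall>\<phi> x. norm (U (bcontfun_vec s \<phi> x)) \<le> norm \<phi> * norm x * K"
    proof (intro exI allI)
      fix \<phi> x
      have "norm (U (bcontfun_vec s \<phi> x)) \<le> norm U * norm (bcontfun_vec s \<phi> x)"
        by (rule norm_blinfun)
      also have "\<dots> \<le> norm U * (norm \<phi> * norm x)"
        by (intro mult_left_mono norm_bcontfun_vec) simp
      finally show "norm (U (bcontfun_vec s \<phi> x)) \<le> norm \<phi> * norm x * norm U"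
        by (simp add: mult.commute)
    qed
  qed (simp_all add: blinfun.bilinear_simps
      bounded_bilinear.add_left[OF bounded_bilinear_bcontfun_vec]
      bounded_bilinear.add_right[OF bounded_bilinear_bcontfun_vec]
      bounded_bilinear.scaleR_left[OF bounded_bilinear_bcontfun_vec]
      bounded_bilinear.scaleR_right[OF bounded_bilinear_bcontfun_vec])
  have eq: "Blinfun (\<lambda>x. U (bcontfun_vec s \<phi> x)) = bounded_bilinear.prod_right
      (\<lambda>\<phi> x. blinfun_apply U (bcontfun_vec s \<phi> x)) \<phi>" for \<phi>
    by (intro blinfun_eqI)
      (simp add: bounded_bilinear.prod_right.rep_eq[OF bb]
        bounded_linear_Blinfun_apply bounded_bilinear.bounded_linear_right[OF bb])
  show ?thesis
    unfolding assoc_op_def eq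
    by (simp add: bounded_linear_Blinfun_apply bounded_bilinear.bounded_linear_prod_right[OF bb]
        bounded_bilinear.prod_right.rep_eq[OF bb])
qed

end

lemma assoc_op_in_operator_valued_over:
  fixes s :: "'k::real_or_complex \<Rightarrow> 'x::real_normed_vector \<Rightarrow> 'x"
    and t :: "'k \<Rightarrow> 'y::real_normed_vector \<Rightarrow> 'y"
    and U :: "('w::topological_space \<Rightarrow>\<^sub>C 'x) \<Rightarrow>\<^sub>L 'y"
  assumes "normed_space_over s" and "normed_space_over t"
    and U: "U \<in> blinfun_over (bcontfun_scale s) t"
  shows "assoc_op s U \<in> operator_valued_over s t"
proof -
  interpret s: normed_space_over s by fact
  interpret t: normed_space_over t by fact
  interpret m: normed_space_over "(*) :: 'k \<Rightarrow> _" by (rule normed_space_over_mult)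
  interpret Cm: normed_space_over "bcontfun_scale (*) :: 'k \<Rightarrow> ('w \<Rightarrow>\<^sub>C 'k) \<Rightarrow> _"
    by (rule m.normed_space_over_bcontfun)
  interpret Lt: normed_space_over "blinfun_scale t :: 'k \<Rightarrow> ('x \<Rightarrow>\<^sub>L 'y) \<Rightarrow> _"
    by (rule t.normed_space_over_blinfun)
  interpret U: Vector_Spaces.linear "bcontfun_scale s" t "blinfun_apply U"
    using U by (simp add: blinfun_over_def)
  have 1: "bcontfun_vec s (bcontfun_scale (*) c \<phi>) x = bcontfun_scale s c (bcontfun_vec s \<phi> x)"
    for c x and \<phi> :: "'w \<Rightarrow>\<^sub>C 'k"
    by (rule bcontfun_eqI)
      (simp add: s.bcontfun_vec_apply s.bcontfun_scale_apply m.bcontfun_scale_apply)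
  have 2: "bcontfun_vec s \<phi> (s c x) = bcontfun_scale s c (bcontfun_vec s \<phi> x)"
    for c x and \<phi> :: "'w \<Rightarrow>\<^sub>C 'k"
    by (rule bcontfun_eqI)
      (simp add: s.bcontfun_vec_apply s.bcontfun_scale_apply mult.commute)
  have "assoc_op s U \<in> blinfun_over (bcontfun_scale (*)) (blinfun_scale t)"
    unfolding blinfun_over_def
    by (auto intro!: Vector_Spaces.linear.intro module_hom.intro module_hom_axioms.intro blinfun_eqI
        Cm.vector_space_axioms Lt.vector_space_axioms Cm.module_axioms Lt.module_axioms
        simp: blinfun.bilinear_simps s.assoc_op_apply t.blinfun_scale_apply 1 U.scale)
  moreover have "blinfun_apply (assoc_op s U) \<phi> \<in> blinfun_over s t" for \<phi>
    unfolding blinfun_over_def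
    by (auto intro!: Vector_Spaces.linear.intro module_hom.intro module_hom_axioms.intro
        s.vector_space_axioms t.vector_space_axioms s.module_axioms t.module_axioms
        simp: blinfun.bilinear_simps s.assoc_op_apply 2 U.scale)
  ultimately show ?thesis
    by (auto simp: operator_valued_over_def)
qed

end

theory Submission
  imports Defs
begin

text \<open>
  If \<open>S = U\<^sup>#\<close> with \<open>S \<phi> = \<Sum>\<^sub>n \<phi>(\<omega>\<^sub>n) g\<^sub>n \<otimes> y\<close>, evaluating \<open>U\<close> at \<open>\<Sum>\<^sub>n \<phi>\<^sub>n x\<^sub>n\<close>, with bump functions \<open>\<phi>\<^sub>n\<close> at \<open>\<omega>\<^sub>n\<close>
  that have disjoint supports and unit vectors \<open>x\<^sub>n\<close> almost norming \<open>g\<^sub>n\<close>, bounds \<open>\<Sum>\<^sub>n \<parallel>g\<^sub>n\<parallel>\<close> by a multiple of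
  \<open>\<parallel>U\<parallel>\<close>, whereas \<open>S\<close> is already bounded when \<open>\<Sum>\<^sub>n \<bar>g\<^sub>n x\<bar> \<le> C \<parallel>x\<parallel>\<close> for all \<open>x\<close>. So it suffices to find such \<open>g\<^sub>n\<close> in the
  dual of \<open>X\<close> with \<open>\<Sum>\<^sub>n \<parallel>g\<^sub>n\<parallel> = \<infinity>\<close>, as in the Dvoretzky--Rogers theorem. If there were none, Pietsch
  domination would give a mean \<open>\<Lambda>\<close> over the unit ball of \<open>X\<close> with \<open>\<parallel>f\<parallel> \<le> C \<Lambda>\<bar>f\<bar> \<le> C \<surd>(\<Lambda> f\<^sup>2)\<close> on the dual. For functionals
  \<open>f\<^sub>1, \<dots>, f\<^sub>n\<close> orthonormal under \<open>\<Lambda>(f g)\<close> and \<open>x\<close> in the unit ball, evaluating \<open>\<Sum>\<^sub>i f\<^sub>i(x) f\<^sub>i\<close> at \<open>x\<close> gives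
  \<open>\<Sum>\<^sub>i f\<^sub>i(x)\<^sup>2 \<le> C\<^sup>2\<close>, so that \<open>n \<le> C\<^sup>2\<close> after applying \<open>\<Lambda>\<close>, which is impossible as \<open>X\<close> is infinite-dimensional.
\<close>

subsection \<open>Hahn--Banach\<close>

text \<open>Homogeneity is asked only as an inequality for \<open>0 < t\<close>, which is what
  infima give directly; \<open>sublinear_scaleR\<close> recovers equality for all
  \<open>0 \<le> t\<close>.\<close>

definition sublinear :: "('a::real_vector \<Rightarrow> real) \<Rightarrow> bool"
  where "sublinear p \<longleftrightarrow> (\<forall>x y. p (x + y) \<le> p x + p y) \<and> (\<forall>x t. 0 < t \<longrightarrow> p (t *\<^sub>R x) \<le> t * p x)"

lemma sublinear_add: "sublinear p \<Longrightarrow> p (x + y) \<le> p x + p y"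
  by (simp add: sublinear_def)

lemma sublinear_scaleR:
  assumes p: "sublinear p" and t: "0 \<le> t"
  shows "p (t *\<^sub>R x) = t * p x"
proof -
  have eq: "p (t *\<^sub>R x) = t * p x" if "0 < t" for t x
  proof (rule antisym)
    show "p (t *\<^sub>R x) \<le> t * p x"
      using p that by (simp add: sublinear_def)
    have "p (inverse t *\<^sub>R (t *\<^sub>R x)) \<le> inverse t * p (t *\<^sub>R x)"
      using p that unfolding sublinear_def by (meson positive_imp_inverse_positive)
    then show "t * p x \<le> p (t *\<^sub>R x)"
      using that by (simp add: field_simps)
  qed
  \<comment> \<open>The instance \<open>eq[of 2 0]\<close> reads \<open>p 0 = 2 * p 0\<close>, so
    \<open>p 0 = 0\<close>, which settles \<open>t = 0\<close>.\<close>
  show ?thesis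
    using eq[of 2 0] eq[of t x] t by (cases "t = 0") auto
qed

lemma sublinear_zero: "sublinear p \<Longrightarrow> p 0 = 0"
  using sublinear_scaleR[of p 0 0] by simp

lemma sublinear_minus: "sublinear p \<Longrightarrow> - p (- x) \<le> p x"
  using sublinear_add[of p x "- x"] sublinear_zero[of p] by simp

lemma sublinear_norm: "sublinear norm"
  by (simp add: sublinear_def norm_triangle_ineq)

text \<open>The infimum of \<open>q (x + t *\<^sub>R y) - t * q y\<close> over
  \<open>0 \<le> t\<close> is sublinear; \<open>t = 0\<close> and \<open>t = 1\<close> give the two
  bounds. The second bound makes minimal functionals additive, and at \<open>x = - y\<close> it
  reads \<open>r (- y) \<le> - q y\<close>, which yields norming functionals.\<close>

lemma sublinear_lower:
  assumes q: "sublinear q"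
  obtains r where "sublinear r" "r \<le> q" "\<And>x. r x \<le> q (x + y) - q y"
proof
  define r where "r x = (INF t\<in>{0..}. q (x + t *\<^sub>R y) - t * q y)" for x
  have bdd: "bdd_below ((\<lambda>t. q (x + t *\<^sub>R y) - t * q y) ` {0..})" for x
  proof (rule bdd_belowI2)
    fix t :: real assume "t \<in> {0..}"
    then show "- q (- x) \<le> q (x + t *\<^sub>R y) - t * q y"
      using sublinear_add[OF q, of "x + t *\<^sub>R y" "- x"] sublinear_scaleR[OF q, of t y] by simp
  qed
  have le: "r x \<le> q (x + t *\<^sub>R y) - t * q y" if "0 \<le> t" for x t
    unfolding r_def using that by (intro cINF_lower bdd) auto
  have ge: "c \<le> r x" if "\<And>t. 0 \<le> t \<Longrightarrow> c \<le> q (x + t *\<^sub>R y) - t * q y" for c x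
    unfolding r_def using that by (intro cINF_greatest) auto
  show "r \<le> q"
    using le[of 0] by (auto simp: le_fun_def)
  show "r x \<le> q (x + y) - q y" for x
    using le[of 1 x] by simp
  show "sublinear r"
    unfolding sublinear_def
  proof (intro conjI allI impI)
    fix x z
    \<comment> \<open>The parameters \<open>t\<close> for \<open>x\<close> and \<open>u\<close> for
      \<open>z\<close> are merged into \<open>t + u\<close>; the infima over \<open>t\<close> and
      over \<open>u\<close> are then taken one after the other.\<close>
    have "r (x + z) - (q (z + u *\<^sub>R y) - u * q y) \<le> q (x + t *\<^sub>R y) - t * q y"
      if "0 \<le> t" "0 \<le> u" for t u
      using le[of "t + u" "x + z"] that sublinear_add[OF q, of "x + t *\<^sub>R y" "z + u *\<^sub>R y"]
      by (simp add: algebra_simps)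
    then have "r (x + z) - (q (z + u *\<^sub>R y) - u * q y) \<le> r x" if "0 \<le> u" for u
      using that by (intro ge) auto
    then have "r (x + z) - r x \<le> r z"
      by (intro ge) (simp add: algebra_simps)
    then show "r (x + z) \<le> r x + r z"
      by simp
  next
    fix x and t :: real assume t: "0 < t"
    have "r (t *\<^sub>R x) / t \<le> r x"
    proof (rule ge)
      fix u :: real assume "0 \<le> u"
      with t have "r (t *\<^sub>R x) \<le> q (t *\<^sub>R (x + u *\<^sub>R y)) - (t * u) * q y"
        using le[of "t * u" "t *\<^sub>R x"] by (simp add: algebra_simps)
      also have "\<dots> = t * (q (x + u *\<^sub>R y) - u * q y)"
        using sublinear_scaleR[OF q, of t "x + u *\<^sub>R y"] t by (simp add: algebra_simps)
      finally show "r (t *\<^sub>R x) / t \<le> q (x + u *\<^sub>R y) - u * q y"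
        using t by (simp add: field_simps)
    qed
    then show "r (t *\<^sub>R x) \<le> t * r x"
      using t by (simp add: field_simps)
  qed
qed

theorem sublinear_dominates_linear:
  assumes p: "sublinear p"
  obtains f where "linear f" "f \<le> p"
proof -
  \<comment> \<open>A minimal sublinear functional below \<open>p\<close> is linear, since \<open>sublinear_lower\<close> cannot lower it.\<close>
  define Q where "Q = {q. sublinear q \<and> q \<le> p}"
  \<comment> \<open>This bound is common to all of \<open>Q\<close> and keeps pointwise infima over
    chains finite.\<close>
  have lower: "- p (- x) \<le> q x" if "q \<in> Q" for q x
  proof -
    have "q (- x) \<le> p (- x)" "- q (- x) \<le> q x"
      using that by (auto simp: Q_def le_fun_def sublinear_minus)
    then show ?thesis by simp
  qed
  have "\<exists>m\<in>Q. \<forall>q\<in>Q. q \<le> m \<longrightarrow> q = m"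
  \<comment> \<open>Zorn's lemma is applied to the reversed order: the upper bound of a chain is its
    pointwise infimum, and a maximal element is a minimal functional.\<close>
  proof (rule predicate_Zorn)
    show "partial_order_on Q (relation_of (\<lambda>q r. r \<le> q) Q)"
      by (rule partial_order_on_relation_ofI) auto
  next
    fix C assume C: "C \<in> Chains (relation_of (\<lambda>q r. r \<le> q) Q)"
    then have CQ: "C \<subseteq> Q"
      by (rule Chains_relation_of)
    have total: "q \<le> r \<or> r \<le> q" if "q \<in> C" "r \<in> C" for q r
      using C that by (auto simp: Chains_def relation_of_def)
    show "\<exists>u\<in>Q. \<forall>q\<in>C. u \<le> q"
    proof (cases "C = {}")
      case True
      then show ?thesis using p by (auto simp: Q_def)
    next
      case False
      define u where "u x = (INF q\<in>C. q x)" for x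
      have le: "u x \<le> q x" if "q \<in> C" for q x
        unfolding u_def using lower CQ that by (intro cINF_lower bdd_belowI2[of _ "- p (- x)"]) auto
      have ge: "c \<le> u x" if "\<And>q. q \<in> C \<Longrightarrow> c \<le> q x" for c x
        unfolding u_def using that False by (intro cINF_greatest)
      have sub: "sublinear q" if "q \<in> C" for q
        using that CQ by (auto simp: Q_def)
      have "sublinear u"
        unfolding sublinear_def
      proof (intro conjI allI impI)
        fix x y
        have "u (x + y) - r y \<le> q x" if "q \<in> C" "r \<in> C" for q r
        proof -
          have "q \<le> r \<or> r \<le> q"
            using that by (rule total)
          \<comment> \<open>The smaller of the two comparable functionals \<open>q\<close> and
            \<open>r\<close> serves at both points.\<close>
          then obtain h where "h \<in> C" "h x \<le> q x" "h y \<le> r y"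
            using \<open>q \<in> C\<close> \<open>r \<in> C\<close> by (auto simp: le_fun_def)
          with le[of h "x + y"] sublinear_add[OF sub[of h], of x y] show ?thesis
            by simp
        qed
        then have "u (x + y) - r y \<le> u x" if "r \<in> C" for r
          using that by (intro ge)
        then have "u (x + y) - u x \<le> u y"
          by (intro ge) (simp add: algebra_simps)
        then show "u (x + y) \<le> u x + u y"
          by simp
      next
        fix x and t :: real assume t: "0 < t"
        have "u (t *\<^sub>R x) / t \<le> u x"
          using le[of _ "t *\<^sub>R x"] sublinear_scaleR[OF sub, of _ t x] t
          by (intro ge) (simp add: field_simps)
        then show "u (t *\<^sub>R x) \<le> t * u x"
          using t by (simp add: field_simps)
      qed
      moreover obtain q where "q \<in> C"
        using False by blast
      then have "u \<le> p"
        using CQ by (auto simp: le_fun_def Q_def intro: order_trans[OF le])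
      ultimately show ?thesis
        using le by (auto simp: Q_def le_fun_def)
    qed
  qed
  then obtain q where q: "sublinear q" "q \<le> p" and min: "\<And>r. r \<in> Q \<Longrightarrow> r \<le> q \<Longrightarrow> r = q"
    by (auto simp: Q_def)
  have add: "q (x + y) = q x + q y" for x y
  proof (rule antisym)
    obtain r where r: "sublinear r" "r \<le> q" "\<And>x. r x \<le> q (x + y) - q y"
      using sublinear_lower[OF q(1)] by blast
    then have "r = q"
      using q(2) by (intro min) (auto simp: Q_def)
    then show "q x + q y \<le> q (x + y)"
      using r(3)[of x] by simp
  qed (rule sublinear_add[OF q(1)])
  have neg: "q (- x) = - q x" for x
    using add[of x "- x"] sublinear_zero[OF q(1)] by simp
  have "q (t *\<^sub>R x) = t * q x" for t x
  proof (cases "0 \<le> t")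
    case False
    then show ?thesis
      using sublinear_scaleR[OF q(1), of "- t" x] neg[of "t *\<^sub>R x"] by simp
  qed (rule sublinear_scaleR[OF q(1)])
  then have "linear q"
    using add by (intro linearI) auto
  with q(2) show ?thesis
    by (rule that[rotated])
qed

text \<open>Lowering the norm in direction \<open>y\<close> before choosing a linear functional
  below it forces \<open>f (- y) \<le> - norm y\<close>.\<close>

theorem norming_functional:
  fixes y :: "'a::real_normed_vector"
  obtains f :: "'a \<Rightarrow>\<^sub>L real" where "\<And>x. f x \<le> norm x" "f y = norm y"
proof -
  obtain r where r: "sublinear r" "r \<le> norm" "\<And>x. r x \<le> norm (x + y) - norm y"
    using sublinear_lower[OF sublinear_norm] by blast
  obtain f where f: "linear f" "f \<le> r"
    using sublinear_dominates_linear[OF r(1)] .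
  have le: "f x \<le> norm x" for x
    using f(2) r(2) by (meson le_fun_def order_trans)
  have "\<bar>f x\<bar> \<le> norm x" for x
    using le[of x] le[of "- x"] linear_neg[OF f(1)] by (simp add: abs_le_iff)
  then have bl: "bounded_linear f"
    using f(1) by (intro linear_conv_bounded_linear[THEN iffD1] bounded_linear_intro[of _ 1])
      (auto simp: linear_add linear_scale)
  have "f (- y) \<le> - norm y"
    using f(2) r(3)[of "- y"] by (auto simp: le_fun_def intro: order_trans)
  then have "f y = norm y"
    using le[of y] linear_neg[OF f(1)] by (intro antisym) auto
  with le show ?thesis
    by (intro that[of "Blinfun f"]) (auto simp: bounded_linear_Blinfun_apply bl)
qed


subsection \<open>A dual Dvoretzky--Rogers theorem\<close>

text \<open>The radial retraction onto the closed unit ball.\<close>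

definition ball_retract :: "'a::real_normed_vector \<Rightarrow> 'a"
  where "ball_retract x = x /\<^sub>R max 1 (norm x)"

lemma norm_ball_retract: "norm (ball_retract x) \<le> 1"
proof -
  have "norm x / max 1 (norm x) \<le> 1"
    by (subst pos_divide_le_eq) (auto simp: less_max_iff_disj)
  then show ?thesis
    by (simp add: ball_retract_def divide_inverse mult.commute)
qed

lemma ball_retract_eq: "norm x \<le> 1 \<Longrightarrow> ball_retract x = x"
  by (simp add: ball_retract_def max_absorb1)

lemma continuous_ball_retract: "continuous_on UNIV ball_retract"
  unfolding ball_retract_def by (intro continuous_intros) auto

lemma abs_blinfun_ball_retract: "\<bar>blinfun_apply f (ball_retract x)\<bar> \<le> norm f"
  using norm_blinfun[of f "ball_retract x"] mult_left_mono[OF norm_ball_retract[of x], of "norm f"]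
  by simp

text \<open>
  Functions on the unit ball are represented by bounded continuous functions on the whole space,
  through composition with the retraction.
\<close>

definition abs_ball :: "('x::real_normed_vector \<Rightarrow>\<^sub>L real) \<Rightarrow> ('x \<Rightarrow>\<^sub>C real)"
  where "abs_ball f = Bcontfun (\<lambda>x. \<bar>blinfun_apply f (ball_retract x)\<bar>)"

definition mult_ball ::
    "('x::real_normed_vector \<Rightarrow>\<^sub>L real) \<Rightarrow> ('x \<Rightarrow>\<^sub>L real) \<Rightarrow> ('x \<Rightarrow>\<^sub>C real)"
  where "mult_ball f g = Bcontfun (\<lambda>x. f (ball_retract x) * g (ball_retract x))"

lemma abs_ball_apply: "abs_ball f x = \<bar>blinfun_apply f (ball_retract x)\<bar>"
proof -
  have "(\<lambda>x. \<bar>blinfun_apply f (ball_retract x)\<bar>) \<in> bcontfun"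
    by (rule bcontfun_normI)
      (auto intro!: continuous_intros continuous_ball_retract abs_blinfun_ball_retract)
  then show ?thesis
    by (simp add: abs_ball_def Bcontfun_inverse)
qed

lemma mult_ball_apply: "mult_ball f g x = f (ball_retract x) * g (ball_retract x)"
proof -
  have "(\<lambda>x. f (ball_retract x) * g (ball_retract x)) \<in> bcontfun"
    by (rule bcontfun_normI[of _ "norm f * norm g"])
      (auto intro!: continuous_intros continuous_ball_retract mult_mono abs_blinfun_ball_retract
        simp: abs_mult)
  then show ?thesis
    by (simp add: mult_ball_def Bcontfun_inverse)
qed

section \<open>Pietsch domination\<close>

text \<open>The assumption \<open>summing\<close> says that the identity of the dual is absolutely
  summing with constant \<open>C\<close>. The functional \<open>\<Lambda>\<close> is positive with
  value 1 at the constant 1 and replaces the probability measure of Pietsch's theorem; it comes from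
  Hahn--Banach, applied to a sublinear functional with the domination built in.\<close>

lemma pietsch_domination:
  fixes C :: real
  assumes C: "0 < C"
    and summing: "\<And>(fs :: ('x::real_normed_vector \<Rightarrow>\<^sub>L real) list) M.
      (\<And>x. norm x \<le> 1 \<Longrightarrow> (\<Sum>f\<leftarrow>fs. \<bar>blinfun_apply f x\<bar>) \<le> M) \<Longrightarrow> (\<Sum>f\<leftarrow>fs. norm f) \<le> C * M"
  obtains \<Lambda> :: "('x::real_normed_vector \<Rightarrow>\<^sub>C real) \<Rightarrow> real"
  where "linear \<Lambda>" "\<And>g r. (\<And>x. apply_bcontfun g x \<le> r) \<Longrightarrow> \<Lambda> g \<le> r"
    "\<And>f. norm f \<le> C * \<Lambda> (abs_ball f)"
proof -
  \<comment> \<open>\<open>P g\<close> are the upper bounds for \<open>\<Lambda> g\<close> that \<open>\<Lambda> h \<le> sup h\<close> and \<open>\<parallel>f\<parallel> \<le> C \<Lambda>\<bar>f\<bar>\<close> impose jointly.\<close>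
  define P where "P g = {r. \<exists>fs :: ('x \<Rightarrow>\<^sub>L real) list.
    \<forall>x. apply_bcontfun g x + C * (\<Sum>f\<leftarrow>fs. \<bar>blinfun_apply f (ball_retract x)\<bar>) \<le> r + (\<Sum>f\<leftarrow>fs. norm f)}" for g
  define p where "p g = Inf (P g)" for g
  have in_P: "r \<in> P g" if "\<And>x. apply_bcontfun g x \<le> r" for g r
    unfolding P_def using that by (intro CollectI exI[of _ "[]"]) auto
  then have ne: "P g \<noteq> {}" for g
    by (metis abs_ge_self norm_bounded real_norm_def order_trans empty_iff)
  \<comment> \<open>Here \<open>summing\<close> enters: a list witnessing \<open>r \<in> P g\<close>
    is weakly bounded by \<open>(r + (\<Sum>f\<leftarrow>fs. norm f) + norm g) / C\<close>, and
    after \<open>summing\<close> the sum of norms cancels.\<close>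
  have bdd: "bdd_below (P g)" for g
  proof (rule bdd_belowI[of _ "- norm g"])
    fix r assume "r \<in> P g"
    then obtain fs :: "('x \<Rightarrow>\<^sub>L real) list" where fs:
      "\<And>x. apply_bcontfun g x + C * (\<Sum>f\<leftarrow>fs. \<bar>blinfun_apply f (ball_retract x)\<bar>) \<le> r + (\<Sum>f\<leftarrow>fs. norm f)"
      by (auto simp: P_def)
    have "(\<Sum>f\<leftarrow>fs. norm f) \<le> C * ((r + (\<Sum>f\<leftarrow>fs. norm f) + norm g) / C)"
    proof (rule summing)
      fix x :: 'x assume "norm x \<le> 1"
      then have "C * (\<Sum>f\<leftarrow>fs. \<bar>blinfun_apply f x\<bar>) \<le> r + (\<Sum>f\<leftarrow>fs. norm f) + norm g"
        using fs[of x] norm_bounded[of g x] by (simp add: ball_retract_eq)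
      then show "(\<Sum>f\<leftarrow>fs. \<bar>blinfun_apply f x\<bar>) \<le> (r + (\<Sum>f\<leftarrow>fs. norm f) + norm g) / C"
        using C by (simp add: field_simps)
    qed
    then show "- norm g \<le> r"
      using C by simp
  qed
  have le: "p g \<le> r" if "r \<in> P g" for g r
    unfolding p_def using that bdd by (rule cInf_lower)
  have ge: "c \<le> p g" if "\<And>r. r \<in> P g \<Longrightarrow> c \<le> r" for g c
    unfolding p_def using ne that by (rule cInf_greatest)
  have "sublinear p"
    unfolding sublinear_def
  proof (intro conjI allI impI)
    fix g h :: "'x \<Rightarrow>\<^sub>C real"
    have "p (g + h) \<le> r + s" if r: "r \<in> P g" and s: "s \<in> P h" for r s
    proof (rule le)
      obtain fs :: "('x \<Rightarrow>\<^sub>L real) list" where fs: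
        "\<And>x. apply_bcontfun g x + C * (\<Sum>f\<leftarrow>fs. \<bar>blinfun_apply f (ball_retract x)\<bar>) \<le> r + (\<Sum>f\<leftarrow>fs. norm f)"
        using r by (auto simp: P_def)
      obtain gs :: "('x \<Rightarrow>\<^sub>L real) list" where gs:
        "\<And>x. apply_bcontfun h x + C * (\<Sum>f\<leftarrow>gs. \<bar>blinfun_apply f (ball_retract x)\<bar>) \<le> s + (\<Sum>f\<leftarrow>gs. norm f)"
        using s by (auto simp: P_def)
      show "r + s \<in> P (g + h)"
        unfolding P_def
      proof (intro CollectI exI[of _ "fs @ gs"] allI)
        fix x :: 'x
        show "(g + h) x + C * (\<Sum>f\<leftarrow>fs @ gs. \<bar>blinfun_apply f (ball_retract x)\<bar>) \<le> r + s + (\<Sum>f\<leftarrow>fs @ gs. norm f)"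
          using fs[of x] gs[of x] by (simp add: algebra_simps)
      qed
    qed
    then have "p (g + h) - s \<le> p g" if "s \<in> P h" for s
      using that by (intro ge) (simp add: algebra_simps)
    then have "p (g + h) - p g \<le> p h"
      by (intro ge) (simp add: algebra_simps)
    then show "p (g + h) \<le> p g + p h"
      by simp
  next
    fix g :: "'x \<Rightarrow>\<^sub>C real" and t :: real assume t: "0 < t"
    have "p (t *\<^sub>R g) \<le> t * r" if r: "r \<in> P g" for r
    proof (rule le)
      obtain fs :: "('x \<Rightarrow>\<^sub>L real) list" where fs:
        "\<And>x. apply_bcontfun g x + C * (\<Sum>f\<leftarrow>fs. \<bar>blinfun_apply f (ball_retract x)\<bar>) \<le> r + (\<Sum>f\<leftarrow>fs. norm f)"
        using r by (auto simp: P_def)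
      show "t * r \<in> P (t *\<^sub>R g)"
        unfolding P_def
      proof (intro CollectI exI[of _ "map (scaleR t) fs"] allI)
        fix x :: 'x
        show "(t *\<^sub>R g) x + C * (\<Sum>f\<leftarrow>map (scaleR t) fs. \<bar>blinfun_apply f (ball_retract x)\<bar>)
            \<le> t * r + (\<Sum>f\<leftarrow>map (scaleR t) fs. norm f)"
          using mult_left_mono[OF fs[of x], of t] t
          by (simp add: o_def blinfun.scaleR_left abs_mult sum_list_const_mult algebra_simps)
      qed
    qed
    then have "p (t *\<^sub>R g) / t \<le> p g"
      using t by (intro ge) (simp add: field_simps)
    then show "p (t *\<^sub>R g) \<le> t * p g"
      using t by (simp add: field_simps)
  qed
  then obtain \<Lambda> where \<Lambda>: "linear \<Lambda>" "\<Lambda> \<le> p"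
    using sublinear_dominates_linear by blast
  show ?thesis
  proof (rule that[OF \<Lambda>(1)])
    fix g :: "'x \<Rightarrow>\<^sub>C real" and r assume "\<And>x. apply_bcontfun g x \<le> r"
    then show "\<Lambda> g \<le> r"
      using \<Lambda>(2) le[OF in_P] by (meson le_fun_def order_trans)
  next
    fix f :: "'x \<Rightarrow>\<^sub>L real"
    \<comment> \<open>With the list \<open>[f]\<close>, both sides of the inequality defining
      \<open>P\<close> are 0.\<close>
    have "- norm f \<in> P (- C *\<^sub>R abs_ball f)"
      unfolding P_def by (intro CollectI exI[of _ "[f]"]) (simp add: abs_ball_apply)
    then have "\<Lambda> (- C *\<^sub>R abs_ball f) \<le> - norm f"
      using \<Lambda>(2) le by (meson le_fun_def order_trans)
    then show "norm f \<le> C * \<Lambda> (abs_ball f)"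
      by (simp add: linear_scale[OF \<Lambda>(1)] linear_neg[OF \<Lambda>(1)])
  qed
qed

section \<open>The identity of the dual is not absolutely summing\<close>

text \<open>Infinite dimension enters as \<open>inf\<close>: the members of a finite orthonormal
  system have a common nontrivial zero, so a norming functional there lies outside their
  span.\<close>

lemma dual_identity_not_summing:
  fixes C :: real
  assumes C: "0 < C"
    and inf: "\<And>A. finite A \<Longrightarrow> \<exists>x::'x::real_normed_vector. x \<noteq> 0 \<and> (\<forall>f\<in>A. blinfun_apply f x = (0::real))"
  obtains fs :: "('x::real_normed_vector \<Rightarrow>\<^sub>L real) list" and M where
    "\<And>x. norm x \<le> 1 \<Longrightarrow> (\<Sum>f\<leftarrow>fs. \<bar>blinfun_apply f x\<bar>) \<le> M" "C * M < (\<Sum>f\<leftarrow>fs. norm f)"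
proof (rule ccontr)
  assume "\<not> thesis"
  with that have "(\<Sum>f\<leftarrow>fs. norm f) \<le> C * M"
    if "\<And>x. norm x \<le> 1 \<Longrightarrow> (\<Sum>f\<leftarrow>fs. \<bar>blinfun_apply f x\<bar>) \<le> M" for fs :: "('x \<Rightarrow>\<^sub>L real) list" and M
    using that by (meson not_le)
  then obtain \<Lambda> :: "('x \<Rightarrow>\<^sub>C real) \<Rightarrow> real" where lin: "linear \<Lambda>"
    and le: "\<And>g r. (\<And>x. apply_bcontfun g x \<le> r) \<Longrightarrow> \<Lambda> g \<le> r"
    and dom: "\<And>f. norm f \<le> C * \<Lambda> (abs_ball f)"
    using pietsch_domination[OF C] by blast
  \<comment> \<open>This is the inner product of the L2 space of \<open>\<Lambda>\<close> on the
    dual; its definiteness comes from \<open>norm_ip\<close>.\<close>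
  define ip where "ip f g = \<Lambda> (mult_ball f g)" for f g :: "'x \<Rightarrow>\<^sub>L real"
  have ip_commute: "ip f g = ip g f" for f g
  proof -
    have "mult_ball f g = mult_ball g f"
      by (rule bcontfun_eqI) (simp add: mult_ball_apply)
    then show ?thesis by (simp add: ip_def)
  qed
  have ip_lin: "linear (\<lambda>f. ip f g)" for g
  proof (rule linearI)
    fix f1 f2 f :: "'x \<Rightarrow>\<^sub>L real" and c :: real
    have "mult_ball (f1 + f2) g = mult_ball f1 g + mult_ball f2 g"
      by (rule bcontfun_eqI) (simp add: mult_ball_apply blinfun.add_left algebra_simps)
    then show "ip (f1 + f2) g = ip f1 g + ip f2 g"
      by (simp add: ip_def linear_add[OF lin])
    have "mult_ball (c *\<^sub>R f) g = c *\<^sub>R mult_ball f g"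
      by (rule bcontfun_eqI) (simp add: mult_ball_apply blinfun.scaleR_left)
    then show "ip (c *\<^sub>R f) g = c *\<^sub>R ip f g"
      by (simp add: ip_def linear_scale[OF lin])
  qed
  have ip_lin': "linear (ip f)" for f
  proof -
    have "ip f = (\<lambda>g. ip g f)"
      by (rule ext) (rule ip_commute)
    then show ?thesis
      using ip_lin by simp
  qed
  \<comment> \<open>\<open>(\<Lambda>\<bar>f\<bar>)\<^sup>2 \<le> \<Lambda> f\<^sup>2\<close>, from \<open>\<Lambda> ((\<bar>f\<bar> - c)\<^sup>2) \<ge> 0\<close> with \<open>c = \<Lambda>\<bar>f\<bar>\<close>.\<close>
  have norm_ip: "(norm f)\<^sup>2 \<le> C\<^sup>2 * ip f f" for f
  proof -
    define c where "c = \<Lambda> (abs_ball f)"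
    have "\<Lambda> (const_bcontfun 1) \<le> 1"
      by (rule le) (simp add: const_bcontfun.rep_eq)
    then have 1: "c\<^sup>2 * \<Lambda> (const_bcontfun 1) \<le> c\<^sup>2"
      by (simp add: mult_left_le)
    have "\<Lambda> (- mult_ball f f + (2 * c) *\<^sub>R abs_ball f - c\<^sup>2 *\<^sub>R const_bcontfun 1) \<le> 0"
    proof (rule le)
      fix x :: 'x
      have "0 \<le> (\<bar>blinfun_apply f (ball_retract x)\<bar> - c)\<^sup>2"
        by simp
      then show "apply_bcontfun (- mult_ball f f + (2 * c) *\<^sub>R abs_ball f - c\<^sup>2 *\<^sub>R const_bcontfun 1) x \<le> 0"
        by (simp add: mult_ball_apply abs_ball_apply const_bcontfun.rep_eq power2_eq_square algebra_simps)
    qed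
    then have "- ip f f + 2 * c * c - c\<^sup>2 * \<Lambda> (const_bcontfun 1) \<le> 0"
      by (simp add: linear_add[OF lin] linear_diff[OF lin] linear_neg[OF lin] linear_scale[OF lin]
          ip_def c_def)
    with 1 have "c\<^sup>2 \<le> ip f f"
      by (simp add: power2_eq_square)
    moreover have "(norm f)\<^sup>2 \<le> (C * c)\<^sup>2"
      using dom[of f] by (intro power_mono) (auto simp: c_def)
    ultimately show ?thesis
      using C by (simp add: power_mult_distrib) (meson mult_left_mono order_trans zero_le_power2)
  qed
  have orthonormal: "\<exists>F. \<forall>i<n. \<forall>j<n. ip (F i) (F j) = (if i = j then 1 else 0)" for n :: nat
  proof (induction n)
    case (Suc n)
    then obtain F :: "nat \<Rightarrow> 'x \<Rightarrow>\<^sub>L real" where F: "\<And>i j. i < n \<Longrightarrow> j < n \<Longrightarrow> ip (F i) (F j) = (if i = j then 1 else 0)"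
      by blast
    obtain x where x: "x \<noteq> 0" "\<And>i. i < n \<Longrightarrow> blinfun_apply (F i) x = 0"
      using inf[of "F ` {..<n}"] by auto
    obtain f :: "'x \<Rightarrow>\<^sub>L real" where f: "f x = norm x"
      using norming_functional[of x] by metis
    \<comment> \<open>A Gram--Schmidt step. All \<open>F i\<close> vanish at \<open>x\<close>, so
      the projection leaves the value \<open>norm x\<close> there unchanged and \<open>g\<close> is
      nonzero.\<close>
    define g where "g = f - (\<Sum>i<n. ip f (F i) *\<^sub>R F i)"
    have "g x = norm x"
      using x(2) f by (simp add: g_def blinfun.bilinear_simps blinfun.sum_left)
    with x(1) have "g \<noteq> 0"
      by auto
    then have pos: "0 < ip g g"
      using norm_ip[of g] C by (smt (verit) mult_nonneg_nonpos zero_le_power2 zero_less_norm_iff zero_less_power)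
    have orth: "ip g (F j) = 0" if "j < n" for j
    proof -
      have "ip g (F j) = ip f (F j) - (\<Sum>i<n. ip f (F i) * ip (F i) (F j))"
        by (simp add: g_def linear_diff[OF ip_lin] linear_sum[OF ip_lin] linear_scale[OF ip_lin])
      also have "(\<Sum>i<n. ip f (F i) * ip (F i) (F j)) = (\<Sum>i<n. if i = j then ip f (F i) else 0)"
        using F that by (intro sum.cong) auto
      finally show ?thesis
        using that by simp
    qed
    define e where "e = (1 / sqrt (ip g g)) *\<^sub>R g"
    have "ip e e = 1"
      using pos by (simp add: e_def linear_scale[OF ip_lin] linear_scale[OF ip_lin'] flip: real_sqrt_mult)
    moreover have "ip e (F j) = 0" "ip (F j) e = 0" if "j < n" for j
      using orth[OF that] ip_commute[of "F j"] by (simp_all add: e_def linear_scale[OF ip_lin])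
    ultimately show ?case
      using F by (intro exI[of _ "F(n := e)"]) (auto simp: less_Suc_eq)
  qed simp
  obtain n :: nat where n: "C\<^sup>2 < n"
    using reals_Archimedean2 by blast
  obtain F :: "nat \<Rightarrow> 'x \<Rightarrow>\<^sub>L real" where F: "\<And>i j. i < n \<Longrightarrow> j < n \<Longrightarrow> ip (F i) (F j) = (if i = j then 1 else 0)"
    using orthonormal[of n] by metis
  have "\<Lambda> (\<Sum>i<n. mult_ball (F i) (F i)) \<le> C\<^sup>2"
  proof (rule le)
    fix x :: 'x
    define y where "y = ball_retract x"
    define s where "s = (\<Sum>i<n. (F i y)\<^sup>2)"
    define f where "f = (\<Sum>i<n. F i y *\<^sub>R F i)"
    have "f y = s"
      by (simp add: f_def s_def blinfun.bilinear_simps blinfun.sum_left power2_eq_square)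
    then have "s \<le> norm f"
      using abs_blinfun_ball_retract[of f x] by (simp add: y_def)
    moreover have s0: "0 \<le> s"
      by (simp add: s_def sum_nonneg)
    ultimately have "s\<^sup>2 \<le> (norm f)\<^sup>2"
      by (intro power_mono)
    also have "\<dots> \<le> C\<^sup>2 * ip f f"
      by (rule norm_ip)
    also have "ip f f = (\<Sum>i<n. \<Sum>j<n. F i y * F j y * ip (F j) (F i))"
      by (simp add: f_def linear_sum[OF ip_lin] linear_scale[OF ip_lin] linear_sum[OF ip_lin']
          linear_scale[OF ip_lin'] sum_distrib_left algebra_simps)
    also have "\<dots> = (\<Sum>i<n. \<Sum>j<n. if j = i then (F i y)\<^sup>2 else 0)"
      using F by (intro sum.cong) (auto simp: power2_eq_square)
    also have "\<dots> = s"
      by (simp add: s_def)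
    \<comment> \<open>The chain reads \<open>s\<^sup>2 \<le> C\<^sup>2 * s\<close>.\<close>
    finally have "s \<le> C\<^sup>2"
      using s0 by (cases "s = 0") (auto simp: power2_eq_square)
    moreover have "apply_bcontfun (\<Sum>i<k. mult_ball (F i) (F i)) x = (\<Sum>i<k. (F i y)\<^sup>2)" for k
      by (induction k) (auto simp: mult_ball_apply y_def power2_eq_square)
    ultimately show "apply_bcontfun (\<Sum>i<n. mult_ball (F i) (F i)) x \<le> C\<^sup>2"
      by (simp add: s_def)
  qed
  moreover have "\<Lambda> (\<Sum>i<n. mult_ball (F i) (F i)) = n"
    using F by (simp add: linear_sum[OF lin] ip_def)
  ultimately show False
    using n by simp
qed

text \<open>Finite lists with weak sums at most \<open>norm x\<close> and norm sums above
  \<open>4 ^ k\<close> are weighted by \<open>(1/2) ^ Suc k\<close>: the weights add up to at most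
  1, while the weighted norm sums still grow without bound.\<close>

theorem dvoretzky_rogers_dual:
  assumes inf: "\<And>A. finite A \<Longrightarrow> \<exists>x::'x::real_normed_vector. x \<noteq> 0 \<and> (\<forall>f\<in>A. blinfun_apply f x = (0::real))"
  obtains g :: "nat \<Rightarrow> 'x::real_normed_vector \<Rightarrow>\<^sub>L real" where
    "\<And>m x. (\<Sum>n<m. \<bar>g n x\<bar>) \<le> norm x" "\<And>r. \<exists>m. r < (\<Sum>n<m. norm (g n))"
proof -
  have "\<exists>fs :: ('x \<Rightarrow>\<^sub>L real) list. (\<forall>x. (\<Sum>f\<leftarrow>fs. \<bar>blinfun_apply f x\<bar>) \<le> norm x) \<and> C < (\<Sum>f\<leftarrow>fs. norm f)"
    if C: "0 < C" for C
  proof -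
    obtain fs :: "('x \<Rightarrow>\<^sub>L real) list" and M where
      M: "\<And>x. norm x \<le> 1 \<Longrightarrow> (\<Sum>f\<leftarrow>fs. \<bar>blinfun_apply f x\<bar>) \<le> M" "C * M < (\<Sum>f\<leftarrow>fs. norm f)"
      using dual_identity_not_summing[OF C inf] by blast
    \<comment> \<open>Since \<open>0 \<le> M\<close>, read off at \<open>x = 0\<close>, a
      \<open>D\<close> strictly above \<open>M\<close> is positive and can be divided by.\<close>
    obtain D where D: "M < D" "C * D < (\<Sum>f\<leftarrow>fs. norm f)"
      using dense[of M "(\<Sum>f\<leftarrow>fs. norm f) / C"] M(2) C by (auto simp: field_simps)
    have "0 < D"
      using M(1)[of 0] D(1) by (simp add: blinfun.zero_right)
    have "(\<Sum>f\<leftarrow>fs. \<bar>blinfun_apply f x\<bar>) \<le> D * norm x" for x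
    proof (cases "x = 0")
      case False
      have "(\<Sum>f\<leftarrow>fs. \<bar>blinfun_apply f (x /\<^sub>R norm x)\<bar>) \<le> D"
        using M(1)[of "x /\<^sub>R norm x"] D(1) False by simp
      then have "inverse (norm x) * (\<Sum>f\<leftarrow>fs. \<bar>blinfun_apply f x\<bar>) \<le> D"
        by (simp add: blinfun.scaleR_right abs_mult flip: sum_list_const_mult)
      then show ?thesis
        using False by (simp add: field_simps)
    qed (simp add: blinfun.zero_right)
    with D(2) \<open>0 < D\<close> show ?thesis
      by (intro exI[of _ "map (\<lambda>f. f /\<^sub>R D) fs"])
        (simp add: o_def blinfun.scaleR_left abs_mult sum_list_const_mult, simp add: field_simps)
  qed
  then have "\<forall>k. \<exists>fs :: ('x \<Rightarrow>\<^sub>L real) list. (\<forall>x. (\<Sum>f\<leftarrow>fs. \<bar>blinfun_apply f x\<bar>) \<le> norm x) \<and> 4 ^ k < (\<Sum>f\<leftarrow>fs. norm f)"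
    by simp
  then obtain fs :: "nat \<Rightarrow> ('x \<Rightarrow>\<^sub>L real) list" where
    fs: "\<And>k x. (\<Sum>f\<leftarrow>fs k. \<bar>blinfun_apply f x\<bar>) \<le> norm x" "\<And>k. 4 ^ k < (\<Sum>f\<leftarrow>fs k. norm f)"
    by metis
  \<comment> \<open>The lists \<open>fs k\<close>, scaled by \<open>2\<^sup>-\<^sup>(\<^sup>k\<^sup>+\<^sup>1\<^sup>)\<close>, are laid out along the pairing function and padded with zeros.\<close>
  define h where "h k j = (if j < length (fs k) then (1/2) ^ Suc k *\<^sub>R fs k ! j else 0)" for k j
  define g where "g n = case_prod h (prod_decode n)" for n
  show ?thesis
  proof (rule that[of g])
    fix m and x :: 'x
    have "(\<Sum>n<m. \<bar>g n x\<bar>) = (\<Sum>p\<in>prod_decode ` {..<m}. \<bar>case_prod h p x\<bar>)"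
      by (subst sum.reindex) (auto simp: g_def inj_prod_decode)
    \<comment> \<open>Both components of a pair are at most its code, so the first \<open>m\<close>
      pairs lie in a square.\<close>
    also have "\<dots> \<le> (\<Sum>p\<in>{..<m} \<times> {..<m}. \<bar>case_prod h p x\<bar>)"
    proof (rule sum_mono2)
      show "prod_decode ` {..<m} \<subseteq> {..<m} \<times> {..<m}"
      proof
        fix p assume "p \<in> prod_decode ` {..<m}"
        then have "prod_encode p < m"
          by auto
        then show "p \<in> {..<m} \<times> {..<m}"
          using le_prod_encode_1[of "fst p" "snd p"] le_prod_encode_2[of "snd p" "fst p"]
          by (cases p) auto
      qed
    qed auto
    also have "\<dots> = (\<Sum>k<m. \<Sum>j<m. \<bar>h k j x\<bar>)"
      by (simp add: sum.cartesian_product case_prod_unfold)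
    also have "\<dots> \<le> (\<Sum>k<m. (1/2) ^ Suc k * norm x)"
    proof (rule sum_mono)
      fix k
      have "(\<Sum>j<m. \<bar>h k j x\<bar>) = (\<Sum>j\<in>{..<m} \<inter> {..<length (fs k)}. (1/2) ^ Suc k * \<bar>(fs k ! j) x\<bar>)"
        by (intro sum.mono_neutral_cong_right) (auto simp: h_def blinfun.scaleR_left abs_mult)
      also have "\<dots> \<le> (\<Sum>j<length (fs k). (1/2) ^ Suc k * \<bar>(fs k ! j) x\<bar>)"
        by (intro sum_mono2) auto
      also have "\<dots> = (1/2) ^ Suc k * (\<Sum>f\<leftarrow>fs k. \<bar>blinfun_apply f x\<bar>)"
        by (simp add: sum_list_sum_nth sum_distrib_left atLeast0LessThan)
      also have "\<dots> \<le> (1/2) ^ Suc k * norm x"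
        using fs(1) by (intro mult_left_mono) auto
      finally show "(\<Sum>j<m. \<bar>h k j x\<bar>) \<le> (1/2) ^ Suc k * norm x" .
    qed
    also have "\<dots> = (1 - (1/2) ^ m) * norm x"
      by (induction m) (auto simp: algebra_simps)
    also have "\<dots> \<le> norm x"
      by (simp add: algebra_simps)
    finally show "(\<Sum>n<m. \<bar>g n x\<bar>) \<le> norm x" .
  next
    fix r :: real
    \<comment> \<open>Block \<open>k\<close> alone has norm sum above
      \<open>2 ^ k / 2\<close>.\<close>
    obtain k :: nat where k: "2 * r < 2 ^ k"
      using real_arch_pow[of 2 "2 * r"] by auto
    define N where "N = (\<lambda>j. prod_encode (k, j)) ` {..<length (fs k)}"
    obtain m where m: "N \<subseteq> {..<m}"
      using finite_nat_iff_bounded[of N] by (auto simp: N_def)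
    have "(4::real) ^ k = 2 ^ k * 2 ^ k"
      by (simp flip: power_mult_distrib)
    then have "2 ^ k / 2 = (1/2) ^ Suc k * (4::real) ^ k"
      by (simp add: power_divide)
    with k have "r < (1/2) ^ Suc k * 4 ^ k"
      by linarith
    also have "\<dots> < (1/2) ^ Suc k * (\<Sum>f\<leftarrow>fs k. norm f)"
      using fs(2) by (intro mult_strict_left_mono) auto
    also have "\<dots> = (\<Sum>j<length (fs k). norm (h k j))"
      by (simp add: sum_list_sum_nth sum_distrib_left atLeast0LessThan h_def)
    also have "\<dots> = (\<Sum>n\<in>N. norm (g n))"
      unfolding N_def by (subst sum.reindex) (auto simp: g_def inj_on_def)
    also have "\<dots> \<le> (\<Sum>n<m. norm (g n))"
      using m by (intro sum_mono2) auto
    finally show "\<exists>m. r < (\<Sum>n<m. norm (g n))" ..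
  qed
qed


subsection \<open>Bump functions and kernels of finitely many functionals\<close>

text \<open>Every infinite open set splits off a nonempty open piece and leaves an infinite open
  remainder; this is iterated. Separate two points: if the neighbourhood \<open>A\<close> of
  \<open>x\<close> meets \<open>W\<close> in an infinite set, that set remains and the other
  neighbourhood gives the piece; otherwise \<open>x\<close> is isolated and \<open>{x}\<close> is
  the piece.\<close>

lemma infinite_t2_disjoint_open:
  assumes "infinite (UNIV :: 'w::t2_space set)"
  obtains V :: "nat \<Rightarrow> 'w::t2_space set" and \<omega> :: "nat \<Rightarrow> 'w"
  where "\<And>n. open (V n)" "\<And>n. \<omega> n \<in> V n" "disjoint_family V"
proof -
  have step: "\<exists>V W' x. open V \<and> x \<in> V \<and> V \<subseteq> W \<and> open W' \<and> infinite W' \<and> W' \<subseteq> W \<and> V \<inter> W' = {}"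
    if W: "open W" "infinite W" for W :: "'w set"
  proof -
    obtain x where x: "x \<in> W"
      using infinite_imp_nonempty[OF W(2)] by blast
    obtain y where y: "y \<in> W" "y \<noteq> x"
      using infinite_imp_nonempty[OF infinite_remove[OF W(2), of x]] by blast
    obtain A B where AB: "open A" "open B" "x \<in> A" "y \<in> B" "A \<inter> B = {}"
      using hausdorff[of x y] y(2) by (auto simp: eq_commute)
    show ?thesis
    proof (cases "finite (A \<inter> W)")
      case False
      then show ?thesis
        using AB W y by (intro exI[of _ "B \<inter> W"] exI[of _ "A \<inter> W"] exI[of _ y]) auto
    next
      case True
      have "open ((A \<inter> W) - (A \<inter> W - {x}))"
        using AB W True by (intro open_Diff open_Int finite_imp_closed) auto
      also have "(A \<inter> W) - (A \<inter> W - {x}) = {x}"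
        using x AB by auto
      finally show ?thesis
        using x W by (intro exI[of _ "{x}"] exI[of _ "W - {x}"] exI[of _ x]) auto
    qed
  qed
  \<comment> \<open>For each \<open>W\<close>, \<open>V' W\<close> is the piece, \<open>P W\<close>
    its point and \<open>N W\<close> the remainder.\<close>
  obtain V' N P where S: "open (V' W) \<and> P W \<in> V' W \<and> V' W \<subseteq> W \<and>
      open (N W) \<and> infinite (N W) \<and> N W \<subseteq> W \<and> V' W \<inter> N W = {}"
    if "open W" "infinite W" for W :: "'w set"
    using step by metis
  define W where "W n = (N ^^ n) UNIV" for n
  have W: "open (W n) \<and> infinite (W n)" for n
    by (induction n) (use assms S in \<open>auto simp: W_def\<close>)
  have WS: "W (Suc n) = N (W n)" for n
    by (simp add: W_def)
  have mono: "W (m + k) \<subseteq> W m" for m k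
    by (induction k) (use S W WS in auto)
  have disj: "V' (W m) \<inter> V' (W n) = {}" if "m < n" for m n
  proof -
    have "V' (W n) \<subseteq> W (Suc m)"
      using S[of "W n"] W mono[of "Suc m" "n - Suc m"] that by auto
    then show ?thesis
      using S[of "W m"] W WS[of m] by auto
  qed
  show ?thesis
  proof (rule that)
    show "open (V' (W n))" "P (W n) \<in> V' (W n)" for n
      using S W by auto
    show "disjoint_family (\<lambda>n. V' (W n))"
      unfolding disjoint_family_on_def using disj by (metis inf_commute linorder_neqE_nat)
  qed
qed

text \<open>Compact Hausdorff spaces are normal, so Urysohn's lemma applies to the closed sets
  \<open>- V\<close> and \<open>{x}\<close>.\<close>

lemma Urysohn_function:
  fixes V :: "'w::t2_space set"
  assumes "compact (UNIV :: 'w::t2_space set)" "open V" "x \<in> V"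
  obtains f :: "'w::t2_space \<Rightarrow> real"
  where "continuous_on UNIV f" "\<And>w. 0 \<le> f w" "\<And>w. f w \<le> 1" "f x = 1" "\<And>w. w \<notin> V \<Longrightarrow> f w = 0"
proof -
  have "Hausdorff_space (euclidean :: 'w topology)"
    using hausdorff[where 'a = 'w] unfolding Hausdorff_space_def disjnt_def
    by (simp only: topspace_euclidean open_openin[symmetric]) blast
  then have "normal_space (euclidean :: 'w topology)"
    using assms(1) by (intro compact_Hausdorff_or_regular_imp_normal_space) (auto simp: compact_space_def)
  then obtain f where "continuous_map euclidean (top_of_set {0..1::real}) f"
      "f ` (- V) \<subseteq> {0}" "f ` {x} \<subseteq> {1}"
    using assms by (elim Urysohn_lemma[where S = "- V" and T = "{x}" and a = 0 and b = "1::real"])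
      (auto simp: closed_Compl)
  then show ?thesis
    by (intro that[of f]) (auto simp: continuous_map_in_subtopology)
qed

lemma disjoint_bumps:
  assumes "compact (UNIV :: 'w::t2_space set)" "infinite (UNIV :: 'w::t2_space set)"
  obtains f :: "nat \<Rightarrow> 'w::t2_space \<Rightarrow> real" and \<omega> :: "nat \<Rightarrow> 'w"
  where "\<And>n. continuous_on UNIV (f n)" "\<And>n w. 0 \<le> f n w" "\<And>n w. f n w \<le> 1"
    "\<And>n. f n (\<omega> n) = 1" "\<And>m n w. m \<noteq> n \<Longrightarrow> f m w \<noteq> 0 \<Longrightarrow> f n w = 0"
proof -
  obtain V :: "nat \<Rightarrow> 'w set" and \<omega> where V: "\<And>n. open (V n)" "\<And>n. \<omega> n \<in> V n" "disjoint_family V"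
    using infinite_t2_disjoint_open[OF assms(2)] by metis
  have "\<forall>n. \<exists>f. continuous_on UNIV f \<and> (\<forall>w. 0 \<le> f w \<and> f w \<le> (1::real)) \<and>
      f (\<omega> n) = 1 \<and> (\<forall>w. w \<notin> V n \<longrightarrow> f w = 0)"
    using Urysohn_function[OF assms(1) V(1) V(2)] by metis
  from choice[OF this] obtain f :: "nat \<Rightarrow> 'w \<Rightarrow> real" where f:
    "\<And>n. continuous_on UNIV (f n)" "\<And>n w. 0 \<le> f n w \<and> f n w \<le> 1"
    "\<And>n. f n (\<omega> n) = 1" "\<And>n w. w \<notin> V n \<Longrightarrow> f n w = 0"
    by blast
  show ?thesis
  proof (rule that[of f \<omega>])
    show "f n w = 0" if "m \<noteq> n" "f m w \<noteq> 0" for m n w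
    proof (rule f(4))
      have "w \<in> V m"
        using that(2) f(4) by blast
      moreover have "V m \<inter> V n = {}"
        using V(3) that(1) by (simp add: disjoint_family_on_def)
      ultimately show "w \<notin> V n"
        by blast
    qed
  qed (use f in auto)
qed

section \<open>Common kernels of finitely many functionals\<close>

text \<open>The common kernel has finite codimension: \<open>span B\<close> meets each of its
  cosets. A new functional adds a vector to \<open>B\<close> only if it does not vanish on the
  kernel of the earlier ones.\<close>

lemma finite_functionals_kernel:
  fixes A :: "('x::real_normed_vector \<Rightarrow>\<^sub>L real) set"
  assumes "finite A"
  obtains B where "finite B" "\<And>x. \<exists>b\<in>span B. \<forall>f\<in>A. f x = f b"
  using assms
proof (induction A arbitrary: thesis)
  case empty
  show ?case by (rule empty[of "{}"]) auto
next
  case (insert f A)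
  obtain B where B: "finite B" "\<And>x. \<exists>b\<in>span B. \<forall>f\<in>A. f x = f b"
    using insert.IH by metis
  show ?case
  proof (cases "\<forall>x. (\<forall>g\<in>A. blinfun_apply g x = 0) \<longrightarrow> f x = 0")
    case True
    have "\<exists>b\<in>span B. \<forall>g\<in>insert f A. g x = g b" for x
    proof -
      obtain b where b: "b \<in> span B" "\<forall>g\<in>A. g x = g b"
        using B(2) by blast
      then have "\<forall>g\<in>A. g (x - b) = 0"
        by (simp add: blinfun.diff_right)
      with True have "f (x - b) = 0"
        by blast
      with b show ?thesis
        by (auto simp: blinfun.diff_right)
    qed
    with B(1) show ?thesis
      by (rule insert.prems)
  next
    case False
    then obtain y where y: "\<forall>g\<in>A. blinfun_apply g y = 0" "f y \<noteq> 0"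
      by blast
    show ?thesis
    proof (rule insert.prems)
      show "\<exists>b\<in>span (insert y B). \<forall>g\<in>insert f A. g x = g b" for x
      proof -
        obtain b where b: "b \<in> span B" "\<forall>g\<in>A. g x = g b"
          using B(2) by blast
        \<comment> \<open>The multiple of \<open>y\<close> corrects the value of \<open>f\<close>
          and leaves those of \<open>A\<close> unchanged.\<close>
        have "b + (f (x - b) / f y) *\<^sub>R y \<in> span (insert y B)"
          using b(1) by (intro span_add span_scale) (auto intro: span_base span_mono[THEN subsetD, of B])
        then show ?thesis
          using b(2) y by (intro bexI) (auto simp: blinfun.bilinear_simps)
      qed
    qed (use B in simp)
  qed
qed

text \<open>With a trivial common kernel, the finite set \<open>B\<close> would span the space over
  the reals, hence over \<open>'k\<close>, and would contain a finite basis.\<close>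

lemma (in normed_space_over) infinite_dimensional_kernel:
  fixes A :: "('x \<Rightarrow>\<^sub>L real) set"
  assumes "\<nexists>B. finite_dimensional_vector_space s B" "finite A"
  obtains x where "x \<noteq> 0" "\<And>f. f \<in> A \<Longrightarrow> f x = 0"
proof (rule ccontr)
  assume "\<not> thesis"
  with that have inj: "x = 0" if "\<And>f. f \<in> A \<Longrightarrow> f x = 0" for x :: 'x
    using that by blast
  obtain B :: "'x set" where B: "finite B" "\<And>x. \<exists>b\<in>Real_Vector_Spaces.span B. \<forall>f\<in>A. f x = f b"
    using finite_functionals_kernel[OF assms(2)] by metis
  have "x \<in> Real_Vector_Spaces.span B" for x
  proof -
    obtain b where "b \<in> Real_Vector_Spaces.span B" "\<forall>f\<in>A. f x = f b"
      using B(2) by blast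
    with inj[of "x - b"] show ?thesis
      by (auto simp: blinfun.diff_right)
  qed
  moreover have "Real_Vector_Spaces.span B \<subseteq> span B"
    by (rule Real_Vector_Spaces.span_minimal)
      (auto simp: Real_Vector_Spaces.subspace_def span_zero span_superset span_base
        intro: span_add span_scale simp flip: scale_of_real)
  ultimately have "span B = UNIV"
    by blast
  moreover obtain B' where "B' \<subseteq> B" "independent B'" "B \<subseteq> span B'"
    using maximal_independent_subset .
  moreover from this have "span B \<subseteq> span B'"
    by (intro span_minimal) auto
  ultimately have "finite_dimensional_vector_space s B'"
    using B(1) by unfold_locales (auto intro: finite_subset)
  with assms(1) show False
    by blast
qed


subsection \<open>The operator\<close>

text \<open>In the complex case a real functional \<open>g\<close> is the real part of the linear
  \<open>G x = g x - g (i x) i\<close>, and \<open>J\<close> is multiplication by \<open>i\<close>;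
  in the real case \<open>G\<close> is \<open>g\<close> and \<open>J\<close> the identity.\<close>

lemma (in normed_space_over) complexify_functional:
  obtains J :: "'x \<Rightarrow> 'x" where "\<And>x. norm (J x) = norm x"
    "\<And>g :: 'x \<Rightarrow>\<^sub>L real. \<exists>G :: 'x \<Rightarrow> 'k. Vector_Spaces.linear s (*) G \<and>
      (\<forall>x. \<bar>g x\<bar> \<le> 2 * norm (G x) \<and> norm (G x) \<le> \<bar>g x\<bar> + \<bar>g (J x)\<bar>)"
proof -
  have K: "vector_space ((*) :: 'k \<Rightarrow> 'k \<Rightarrow> 'k)"
    using normed_space_over_mult by (rule normed_space_over.axioms(1))
  have linI: "Vector_Spaces.linear s (*) G"
    if "\<And>x y. G (x + y) = G x + G y" "\<And>c x. G (s c x) = c * G x" for G :: "'x \<Rightarrow> 'k"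
    using that by (auto intro!: Vector_Spaces.linear.intro module_hom.intro module_hom_axioms.intro
        vector_space_axioms module_axioms K K[folded module_iff_vector_space])
  consider "\<forall>z::'k. \<exists>a. z = a *\<^sub>R 1" |
    i :: 'k where "i * i = - 1" "\<forall>z. \<exists>a b. z = a *\<^sub>R 1 + b *\<^sub>R i"
    using real_or_complex[where 'a = 'k] by blast
  then show ?thesis
  proof cases
    case 1
    show ?thesis
    proof (rule that[of "\<lambda>x. x"])
      fix g :: "'x \<Rightarrow>\<^sub>L real"
      have "of_real (g (s c x)) = c * of_real (g x)" for c x
      proof -
        obtain a where "c = of_real a"
          using 1 by (auto simp: scaleR_conv_of_real)
        then show ?thesis
          by (simp add: scale_of_real blinfun.scaleR_right)
      qed
      then have "Vector_Spaces.linear s (*) (\<lambda>x. of_real (g x) :: 'k)"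
        by (intro linI) (simp_all add: blinfun.add_right)
      then show "\<exists>G :: 'x \<Rightarrow> 'k. Vector_Spaces.linear s (*) G \<and>
          (\<forall>x. \<bar>g x\<bar> \<le> 2 * norm (G x) \<and> norm (G x) \<le> \<bar>g x\<bar> + \<bar>g x\<bar>)"
        by (intro exI[of _ "\<lambda>x. of_real (g x)"]) auto
    qed simp
  next
    case 2
    have "(norm i)\<^sup>2 = norm (i * i)"
      by (simp add: norm_mult power2_eq_square)
    then have ni: "norm i = 1"
      using norm_ge_zero[of i] by (simp add: 2(1) power2_eq_1_iff)
    show ?thesis
    proof (rule that[of "s i"])
      show "norm (s i x) = norm x" for x
        by (simp add: norm_scale ni)
    next
      fix g :: "'x \<Rightarrow>\<^sub>L real"
      define G where "G x = of_real (g x) - of_real (g (s i x)) * i" for x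
      have "G (s c x) = c * G x" for c x
      proof -
        obtain a b where c: "c = of_real a + of_real b * i"
          using spec[OF 2(2), of c] by (auto simp: scaleR_conv_of_real)
        have "s c x = a *\<^sub>R x + b *\<^sub>R s i x"
          by (simp add: c scale_left_distrib scale_of_real flip: scale_scale)
        moreover have "s i (a *\<^sub>R x + b *\<^sub>R s i x) = a *\<^sub>R s i x - b *\<^sub>R x"
          using bounded_bilinear.scaleR_right[OF bounded_bilinear_scale]
          by (simp add: scale_right_distrib 2(1))
        ultimately have "G (s c x) = of_real (a * g x + b * g (s i x)) - of_real (a * g (s i x) - b * g x) * i"
          by (simp add: G_def blinfun.bilinear_simps)
        also have "\<dots> = of_real a * G x + of_real b * (i * of_real (g x) - (i * i) * of_real (g (s i x)))"
          unfolding 2(1) by (simp add: G_def algebra_simps)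
        also have "\<dots> = c * G x"
          by (simp add: G_def c algebra_simps)
        finally show ?thesis .
      qed
      then have "Vector_Spaces.linear s (*) G"
        by (intro linI) (simp_all add: G_def blinfun.add_right scale_right_distrib algebra_simps)
      moreover have "norm (G x) \<le> \<bar>g x\<bar> + \<bar>g (s i x)\<bar>" for x
        unfolding G_def by (rule order_trans[OF norm_triangle_ineq4]) (simp add: norm_mult ni)
      moreover have "\<bar>g x\<bar> \<le> 2 * norm (G x)" for x
      proof -
        define a b where "a = g x" and "b = g (s i x)"
        \<comment> \<open>The second factor is the conjugate of \<open>G x = a - b i\<close>. The
          factor 2 comes from \<open>(\<bar>a\<bar> + \<bar>b\<bar>)\<^sup>2 \<le> 2 * (a\<^sup>2 +
          b\<^sup>2)\<close>.\<close>
        have "G x * (of_real a + of_real b * i) = of_real a * of_real a - of_real b * of_real b * (i * i)"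
          by (simp add: G_def a_def b_def algebra_simps)
        also have "\<dots> = of_real (a\<^sup>2 + b\<^sup>2)"
          by (simp add: 2(1) power2_eq_square)
        finally have "norm (G x) * norm (of_real a + of_real b * i) = a\<^sup>2 + b\<^sup>2"
          by (metis abs_of_nonneg norm_mult norm_of_real sum_power2_ge_zero)
        moreover have "norm (of_real a + of_real b * i) \<le> \<bar>a\<bar> + \<bar>b\<bar>"
          by (rule order_trans[OF norm_triangle_ineq]) (simp add: norm_mult ni)
        ultimately have "a\<^sup>2 + b\<^sup>2 \<le> norm (G x) * (\<bar>a\<bar> + \<bar>b\<bar>)"
          by (metis mult_left_mono norm_ge_zero)
        moreover have "0 \<le> (\<bar>a\<bar> - \<bar>b\<bar>)\<^sup>2"
          by simp
        ultimately have "(\<bar>a\<bar> + \<bar>b\<bar>) * (\<bar>a\<bar> + \<bar>b\<bar>) \<le> (2 * norm (G x)) * (\<bar>a\<bar> + \<bar>b\<bar>)"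
          by (simp add: power2_eq_square algebra_simps)
        then have "\<bar>a\<bar> + \<bar>b\<bar> \<le> 2 * norm (G x)"
          using norm_ge_zero[of "G x"]
          by (cases "0 < \<bar>a\<bar> + \<bar>b\<bar>") (blast intro: mult_right_le_imp_le, linarith)
        then show ?thesis
          by (simp add: a_def)
      qed
      ultimately show "\<exists>G :: 'x \<Rightarrow> 'k. Vector_Spaces.linear s (*) G \<and>
          (\<forall>x. \<bar>g x\<bar> \<le> 2 * norm (G x) \<and> norm (G x) \<le> \<bar>g x\<bar> + \<bar>g (s i x)\<bar>)"
        by (intro exI[of _ G]) auto
    qed
  qed
qed

text \<open>Divergence is expressed through points \<open>x n\<close> of the unit ball, since these
  become the values of the test function. The constant 2 counts the two terms \<open>g n x\<close>
  and \<open>g n (J x)\<close>.\<close>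

theorem (in normed_space_over) dvoretzky_rogers_dual_over:
  assumes "\<nexists>B. finite_dimensional_vector_space s B"
  obtains G :: "nat \<Rightarrow> 'x \<Rightarrow> 'k" where "\<And>n. Vector_Spaces.linear s (*) (G n)"
    "\<And>m x. (\<Sum>n<m. norm (G n x)) \<le> 2 * norm x"
    "\<And>r. \<exists>m x. (\<forall>n. norm (x n) \<le> 1) \<and> r < (\<Sum>n<m. norm (G n (x n)))"
proof -
  obtain J :: "'x \<Rightarrow> 'x" where J: "\<And>x. norm (J x) = norm x"
    "\<And>g :: 'x \<Rightarrow>\<^sub>L real. \<exists>G :: 'x \<Rightarrow> 'k. Vector_Spaces.linear s (*) G \<and>
      (\<forall>x. \<bar>g x\<bar> \<le> 2 * norm (G x) \<and> norm (G x) \<le> \<bar>g x\<bar> + \<bar>g (J x)\<bar>)"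
    using complexify_functional by blast
  have "\<exists>x::'x. x \<noteq> 0 \<and> (\<forall>f\<in>A. blinfun_apply f x = (0::real))" if "finite A" for A
    using infinite_dimensional_kernel[OF assms that] by metis
  then obtain g :: "nat \<Rightarrow> 'x \<Rightarrow>\<^sub>L real" where
    g: "\<And>m x. (\<Sum>n<m. \<bar>g n x\<bar>) \<le> norm x" "\<And>r. \<exists>m. r < (\<Sum>n<m. norm (g n))"
    using dvoretzky_rogers_dual by blast
  have "\<forall>n. \<exists>G :: 'x \<Rightarrow> 'k. Vector_Spaces.linear s (*) G \<and>
      (\<forall>x. \<bar>g n x\<bar> \<le> 2 * norm (G x) \<and> norm (G x) \<le> \<bar>g n x\<bar> + \<bar>g n (J x)\<bar>)"
    using J(2) by blast
  from choice[OF this] obtain G :: "nat \<Rightarrow> 'x \<Rightarrow> 'k" where G: "\<And>n. Vector_Spaces.linear s (*) (G n)"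
    "\<And>n x. \<bar>g n x\<bar> \<le> 2 * norm (G n x)" "\<And>n x. norm (G n x) \<le> \<bar>g n x\<bar> + \<bar>g n (J x)\<bar>"
    by blast
  show ?thesis
  proof (rule that[OF G(1)])
    fix m and x :: 'x
    have "(\<Sum>n<m. norm (G n x)) \<le> (\<Sum>n<m. \<bar>g n x\<bar>) + (\<Sum>n<m. \<bar>g n (J x)\<bar>)"
      unfolding sum.distrib[symmetric] by (intro sum_mono G(3))
    then show "(\<Sum>n<m. norm (G n x)) \<le> 2 * norm x"
      using g(1)[of x m] g(1)[of "J x" m] J(1)[of x] by simp
  next
    fix r :: real
    have "\<exists>x. norm x \<le> 1 \<and> norm (g n) \<le> 2 * \<bar>g n x\<bar>" for n
    proof (cases "g n = 0")
      case False
      then have "\<not> norm (g n) \<le> norm (g n) / 2"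
        by simp
      then obtain x where x: "norm (g n) / 2 * norm x < norm (g n x)"
        by (metis norm_blinfun_bound not_le norm_ge_zero half_gt_zero_iff order_less_imp_le zero_less_norm_iff False)
      then have "x \<noteq> 0"
        by (auto simp: blinfun.zero_right)
      then show ?thesis
        using x by (intro exI[of _ "x /\<^sub>R norm x"]) (simp add: blinfun.scaleR_right abs_mult field_simps)
    qed (intro exI[of _ 0], simp)
    then obtain x where x: "\<And>n. norm (x n) \<le> 1" "\<And>n. norm (g n) \<le> 2 * \<bar>g n (x n)\<bar>"
      by metis
    \<comment> \<open>One factor 2 is lost because \<open>x n\<close> norms \<open>g n\<close> only
      up to 2, another in passing from \<open>g n\<close> to \<open>G n\<close>.\<close>
    obtain m where "4 * r < (\<Sum>n<m. norm (g n))"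
      using g(2) by blast
    also have "\<dots> \<le> (\<Sum>n<m. 4 * norm (G n (x n)))"
    proof (rule sum_mono)
      show "norm (g n) \<le> 4 * norm (G n (x n))" for n
        using x(2)[of n] G(2)[of n "x n"] by linarith
    qed
    finally have "r < (\<Sum>n<m. norm (G n (x n)))"
      by (simp flip: sum_distrib_left)
    with x(1) show "\<exists>m x. (\<forall>n. norm (x n) \<le> 1) \<and> r < (\<Sum>n<m. norm (G n (x n)))"
      by blast
  qed
qed

lemma blinfun_of_bounded_bilinear:
  assumes bb: "bounded_bilinear b"
  obtains S where "\<And>x y. blinfun_apply (blinfun_apply S x) y = b x y"
proof
  show "blinfun_apply (Blinfun (bounded_bilinear.prod_right b)) x y = b x y" for x y
    by (simp add: bounded_linear_Blinfun_apply bounded_bilinear.bounded_linear_prod_right[OF bb]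
        bounded_bilinear.prod_right.rep_eq[OF bb])
qed

text \<open>This is currying; the real homogeneity required by \<open>bounded_bilinear\<close> is
  the case of real scalars.\<close>

lemma operator_of_bilinear:
  fixes sX :: "'k::real_or_complex \<Rightarrow> 'x::real_normed_vector \<Rightarrow> 'x"
    and sY :: "'k \<Rightarrow> 'y::real_normed_vector \<Rightarrow> 'y"
    and b :: "('w::topological_space \<Rightarrow>\<^sub>C 'k) \<Rightarrow> 'x \<Rightarrow> 'y"
  assumes X: "normed_space_over sX" and Y: "normed_space_over sY"
    and add_left: "\<And>\<phi> \<psi> x. b (\<phi> + \<psi>) x = b \<phi> x + b \<psi> x"
    and add_right: "\<And>\<phi> x y. b \<phi> (x + y) = b \<phi> x + b \<phi> y"
    and scale_left: "\<And>c \<phi> x. b (bcontfun_scale (*) c \<phi>) x = sY c (b \<phi> x)"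
    and scale_right: "\<And>c \<phi> x. b \<phi> (sX c x) = sY c (b \<phi> x)"
    and bound: "\<And>\<phi> x. norm (b \<phi> x) \<le> norm \<phi> * norm x * C"
  obtains S where "S \<in> operator_valued_over sX sY" "\<And>\<phi> x. blinfun_apply (blinfun_apply S \<phi>) x = b \<phi> x"
proof -
  interpret X: normed_space_over sX by fact
  interpret Y: normed_space_over sY by fact
  interpret m: normed_space_over "(*) :: 'k \<Rightarrow> _" by (rule normed_space_over_mult)
  interpret Cm: normed_space_over "bcontfun_scale (*) :: 'k \<Rightarrow> ('w \<Rightarrow>\<^sub>C 'k) \<Rightarrow> _"
    by (rule m.normed_space_over_bcontfun)
  interpret Lt: normed_space_over "blinfun_scale sY :: 'k \<Rightarrow> ('x \<Rightarrow>\<^sub>L 'y) \<Rightarrow> _"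
    by (rule Y.normed_space_over_blinfun)
  have "bounded_bilinear b"
  proof
    show "b (r *\<^sub>R \<phi>) x = r *\<^sub>R b \<phi> x" for r \<phi> x
      by (simp add: scale_left flip: Cm.scale_of_real Y.scale_of_real)
    show "b \<phi> (r *\<^sub>R x) = r *\<^sub>R b \<phi> x" for r \<phi> x
      by (simp add: scale_right flip: X.scale_of_real Y.scale_of_real)
    show "\<exists>K. \<forall>\<phi> x. norm (b \<phi> x) \<le> norm \<phi> * norm x * K"
      using bound by blast
  qed (simp_all add: add_left add_right)
  then obtain S where S: "\<And>\<phi> x. blinfun_apply (blinfun_apply S \<phi>) x = b \<phi> x"
    by (rule blinfun_of_bounded_bilinear) blast
  have "S \<in> blinfun_over (bcontfun_scale (*)) (blinfun_scale sY)"
    unfolding blinfun_over_def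
    by (auto intro!: Vector_Spaces.linear.intro module_hom.intro module_hom_axioms.intro blinfun_eqI
        Cm.vector_space_axioms Lt.vector_space_axioms Cm.module_axioms Lt.module_axioms
        simp: blinfun.bilinear_simps S Y.blinfun_scale_apply scale_left)
  moreover have "blinfun_apply S \<phi> \<in> blinfun_over sX sY" for \<phi>
    unfolding blinfun_over_def
    by (auto intro!: Vector_Spaces.linear.intro module_hom.intro module_hom_axioms.intro
        X.vector_space_axioms Y.vector_space_axioms X.module_axioms Y.module_axioms
        simp: blinfun.bilinear_simps S scale_right)
  ultimately show ?thesis
    using S by (intro that[of S]) (auto simp: operator_valued_over_def)
qed

theorem mainTheorem3:
  fixes sX :: "'k::real_or_complex \<Rightarrow> 'x::banach \<Rightarrow> 'x"
    and sY :: "'k \<Rightarrow> 'y::banach \<Rightarrow> 'y"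
  assumes "compact (UNIV :: 'w::t2_space set)"
    and "infinite (UNIV :: 'w set)"
    and "normed_space_over sX"
    and "normed_space_over sY"
    and "\<nexists>B. finite_dimensional_vector_space sX B"
    and "(UNIV :: 'y set) \<noteq> {0}"
  shows "\<exists>S :: ('w \<Rightarrow>\<^sub>C 'k) \<Rightarrow>\<^sub>L ('x \<Rightarrow>\<^sub>L 'y). S \<in> operator_valued_over sX sY \<and>
    (\<forall>U :: ('w \<Rightarrow>\<^sub>C 'x) \<Rightarrow>\<^sub>L 'y. U \<in> blinfun_over (bcontfun_scale sX) sY \<longrightarrow> S \<noteq> assoc_op sX U)"
proof -
  interpret X: normed_space_over sX by fact
  interpret Y: normed_space_over sY by fact
  interpret m: normed_space_over "(*) :: 'k \<Rightarrow> _" by (rule normed_space_over_mult)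
  obtain y :: 'y where y: "y \<noteq> 0"
    using assms(6) by blast
  obtain f :: "nat \<Rightarrow> 'w \<Rightarrow> real" and \<omega> :: "nat \<Rightarrow> 'w" where
    f: "\<And>n. continuous_on UNIV (f n)" "\<And>n w. 0 \<le> f n w" "\<And>n w. f n w \<le> 1"
      "\<And>n. f n (\<omega> n) = 1" "\<And>m n w. m \<noteq> n \<Longrightarrow> f m w \<noteq> 0 \<Longrightarrow> f n w = 0"
    using disjoint_bumps[OF assms(1,2)] by metis
  obtain G :: "nat \<Rightarrow> 'x \<Rightarrow> 'k" where G_lin: "\<And>n. Vector_Spaces.linear sX (*) (G n)"
    and G_le: "\<And>m x. (\<Sum>n<m. norm (G n x)) \<le> 2 * norm x"
    and G_unbounded: "\<And>r. \<exists>m x. (\<forall>n. norm (x n) \<le> 1) \<and> r < (\<Sum>n<m. norm (G n (x n)))"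
    using X.dvoretzky_rogers_dual_over[OF assms(5)] by blast
  have G_add: "G n (x + z) = G n x + G n z" and G_scale: "G n (sX c x) = c * G n x" for n x z c
    using G_lin[of n] by (auto simp: linear.axioms module_hom.add module_hom.scale Vector_Spaces.linear_def)
  define T where "T \<phi> x n = sY (apply_bcontfun \<phi> (\<omega> n) * G n x) y" for \<phi> :: "'w \<Rightarrow>\<^sub>C 'k" and x n
  \<comment> \<open>This is the bilinear map of \<open>S\<close>, a series of point masses at
    \<open>\<omega> n\<close> with coefficients \<open>G n\<close> times \<open>y\<close>. It
    converges absolutely for each \<open>x\<close> by \<open>G_le\<close>, although the norms of the
    \<open>G n\<close> are not summable.\<close>
  define b where "b \<phi> x = (\<Sum>n. T \<phi> x n)" for \<phi> x
  have G_summable: "summable (\<lambda>n. norm (G n x))" and G_suminf: "(\<Sum>n. norm (G n x)) \<le> 2 * norm x" for x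
  proof -
    show "summable (\<lambda>n. norm (G n x))"
      by (rule summableI_nonneg_bounded[of _ "2 * norm x"]) (auto intro: G_le)
    then show "(\<Sum>n. norm (G n x)) \<le> 2 * norm x"
      by (rule suminf_le_const) (rule G_le)
  qed
  have T_le: "norm (T \<phi> x n) \<le> norm \<phi> * norm y * norm (G n x)" for \<phi> x n
  proof -
    have "norm (apply_bcontfun \<phi> (\<omega> n)) * (norm (G n x) * norm y) \<le> norm \<phi> * (norm (G n x) * norm y)"
      by (intro mult_right_mono norm_bounded) simp
    then show ?thesis
      by (simp add: T_def Y.norm_scale norm_mult algebra_simps)
  qed
  have T_norm_summable: "summable (\<lambda>n. norm (T \<phi> x n))" for \<phi> x
    by (rule summable_comparison_test'[OF summable_mult[OF G_summable], of 0 _ "norm \<phi> * norm y" x])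
      (simp add: T_le)
  then have T_summable: "summable (T \<phi> x)" for \<phi> x
    by (rule summable_norm_cancel)
  have scale_suminf: "(\<Sum>n. sY c (T \<phi> x n)) = sY c (b \<phi> x)" for c \<phi> x
    unfolding b_def
    by (rule bounded_linear.suminf[symmetric,
          OF bounded_bilinear.bounded_linear_right[OF Y.bounded_bilinear_scale] T_summable])
  obtain S where S: "S \<in> operator_valued_over sX sY" "\<And>\<phi> x. blinfun_apply (blinfun_apply S \<phi>) x = b \<phi> x"
  proof (rule operator_of_bilinear[OF assms(3,4), of b "2 * norm y"])
    fix \<phi> \<psi> x z c
    have "T (\<phi> + \<psi>) x n = T \<phi> x n + T \<psi> x n" for n
      by (simp add: T_def distrib_right Y.scale_left_distrib)
    then show "b (\<phi> + \<psi>) x = b \<phi> x + b \<psi> x"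
      by (simp add: b_def suminf_add T_summable)
    have "T \<phi> (x + z) n = T \<phi> x n + T \<phi> z n" for n
      by (simp add: T_def G_add distrib_left Y.scale_left_distrib)
    then show "b \<phi> (x + z) = b \<phi> x + b \<phi> z"
      by (simp add: b_def suminf_add T_summable)
    have "T (bcontfun_scale (*) c \<phi>) x n = sY c (T \<phi> x n)" for n
      by (simp add: T_def m.bcontfun_scale_apply mult.assoc)
    then have "b (bcontfun_scale (*) c \<phi>) x = (\<Sum>n. sY c (T \<phi> x n))"
      by (simp add: b_def)
    then show "b (bcontfun_scale (*) c \<phi>) x = sY c (b \<phi> x)"
      by (simp only: scale_suminf)
    have "T \<phi> (sX c x) n = sY c (T \<phi> x n)" for n
      by (simp add: T_def G_scale mult.left_commute)
    then have "b \<phi> (sX c x) = (\<Sum>n. sY c (T \<phi> x n))"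
      by (simp add: b_def)
    then show "b \<phi> (sX c x) = sY c (b \<phi> x)"
      by (simp only: scale_suminf)
    have "norm (b \<phi> x) \<le> (\<Sum>n. norm (T \<phi> x n))"
      unfolding b_def by (rule summable_norm[OF T_norm_summable])
    also have "\<dots> \<le> (\<Sum>n. norm \<phi> * norm y * norm (G n x))"
      by (rule suminf_le[OF T_le T_norm_summable summable_mult[OF G_summable]])
    also have "\<dots> = norm \<phi> * norm y * (\<Sum>n. norm (G n x))"
      by (rule suminf_mult[OF G_summable])
    also have "\<dots> \<le> norm \<phi> * norm y * (2 * norm x)"
      by (intro mult_left_mono G_suminf) simp
    finally show "norm (b \<phi> x) \<le> norm \<phi> * norm x * (2 * norm y)"
      by (simp add: algebra_simps)
  qed blast
  have "S \<noteq> assoc_op sX U" for U :: "('w \<Rightarrow>\<^sub>C 'x) \<Rightarrow>\<^sub>L 'y"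
  proof
    assume U: "S = assoc_op sX U"
    define \<Phi> :: "nat \<Rightarrow> 'w \<Rightarrow>\<^sub>C 'k" where "\<Phi> n = Bcontfun (\<lambda>w. of_real (f n w))" for n
    have \<Phi>: "\<Phi> n w = of_real (f n w)" for n w
    proof -
      have "(\<lambda>w. of_real (f n w) :: 'k) \<in> bcontfun"
        by (rule bcontfun_normI[of _ 1]) (use f(1-3) in \<open>auto intro!: continuous_intros\<close>)
      then show ?thesis
        by (simp add: \<Phi>_def Bcontfun_inverse)
    qed
    obtain m x where x: "\<And>n. norm (x n) \<le> 1" and big: "norm U / norm y < (\<Sum>n<m. norm (G n (x n)))"
      using G_unbounded by metis
    \<comment> \<open>Unimodular factors rotate the values \<open>G n (x n)\<close> to nonnegative
      reals, so that they add up without cancellation.\<close>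
    have "\<exists>c. norm c = 1 \<and> c * z = of_real (norm z)" for z :: 'k
    proof (cases "z = 0")
      case False
      then show ?thesis
        by (intro exI[of _ "of_real (norm z) / z"]) (simp add: norm_divide)
    qed (auto intro: exI[of _ 1])
    then obtain c where c: "\<And>z::'k. norm (c z) = 1" "\<And>z. c z * z = of_real (norm z)"
      by metis
    define u where "u n = sX (c (G n (x n))) (x n)" for n
    have u: "norm (u n) \<le> 1" "G n (u n) = of_real (norm (G n (x n)))" for n
      using x c by (simp_all add: u_def X.norm_scale G_scale)
    have U_eq: "U (bcontfun_vec sX (\<Phi> n) (u n)) = norm (G n (x n)) *\<^sub>R y" for n
    proof -
      have "U (bcontfun_vec sX (\<Phi> n) (u n)) = (\<Sum>k. T (\<Phi> n) (u n) k)"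
        by (simp add: S(2) b_def flip: X.assoc_op_apply U)
      \<comment> \<open>Since \<open>f k\<close> is 1 at \<open>\<omega> k\<close>, disjointness
        makes \<open>f n\<close> vanish there for \<open>n \<noteq> k\<close>.\<close>
      also have "\<dots> = (\<Sum>k\<in>{n}. T (\<Phi> n) (u n) k)"
        by (rule suminf_finite) (use f(4,5) in \<open>auto simp: T_def \<Phi>\<close>)
      also have "\<dots> = norm (G n (x n)) *\<^sub>R y"
        by (simp add: T_def \<Phi> f(4) u Y.scale_of_real)
      finally show ?thesis .
    qed
    define F where "F = (\<Sum>n<m. bcontfun_vec sX (\<Phi> n) (u n))"
    have "norm F \<le> 1"
    proof (rule norm_bound)
      fix w
      have "F w = (\<Sum>n<m. bcontfun_vec sX (\<Phi> n) (u n) w)"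
        unfolding F_def by (induction m) auto
      then have "norm (F w) \<le> (\<Sum>n<m. norm (bcontfun_vec sX (\<Phi> n) (u n) w))"
        by (simp add: norm_sum)
      also have "\<dots> \<le> (\<Sum>n<m. f n w)"
        using f(2) u(1) by (intro sum_mono) (simp add: X.bcontfun_vec_apply X.norm_scale \<Phi> mult_left_le)
      \<comment> \<open>At most one bump is nonzero at \<open>w\<close>, so the bound does not grow
        with \<open>m\<close>.\<close>
      also have "\<dots> \<le> 1"
      proof (cases "\<exists>k. f k w \<noteq> 0")
        case True
        then obtain k where "f k w \<noteq> 0" ..
        then have "(\<Sum>n<m. f n w) = (\<Sum>n<m. if n = k then f n w else 0)"
          using f(5)[of k _ w] by (intro sum.cong) auto
        then show ?thesis
          using f(3) by simp
      qed simp
      finally show "norm (F w) \<le> 1" .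
    qed
    then have "norm (U F) \<le> norm U"
      using norm_blinfun[of U F] mult_left_mono[of "norm F" 1 "norm U"] by simp
    moreover have "U F = (\<Sum>n<m. norm (G n (x n))) *\<^sub>R y"
      by (simp add: F_def blinfun.sum_right U_eq scaleR_left.sum)
    ultimately have "(\<Sum>n<m. norm (G n (x n))) * norm y \<le> norm U"
      by (simp add: sum_nonneg)
    with big y show False
      by (simp add: field_simps)
  qed
  with S(1) show ?thesis
    by blast
qed


end
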